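(* Let $r,\lambda\in(0,1)$. Then there exists a constant $c>0$ depending only on $r,\lambda$ such that for every $a\in\overline{\mathbb C}$ and every logarithmic tract $U\subset\mathbb C$ of $f:U\to V$ over $a$, where $V=\{z\in\overline{\mathbb C}:0<d(z,a)<r\}$ and $0\notin U$, for every $z_1,z_2\in V$ with $d(z_1,a)\le d(z_2,a)\le\lambda r$ and every branch $g$ of $f^{-1}$ in a neighbourhood of $z_1$ (or $z_2$), we have $$c^{-1}\frac{d(z_2,a)}{d(z_1,a)}\left(\frac{\ln(1/d(z_1,a))}{\ln(1/d(z_2,a))}\right)^{-3}\le\frac{|g^*(z_1)|}{|g^*(z_2)|}\le c\,\frac{d(z_2,a)}{d(z_1,a)}\,\frac{\ln(1/d(z_1,a))}{\ln(1/d(z_2,a))}\qquad(\star)$$ for some extension of the branch $g$ to a neighbourhood of $z_2$ (or $z_1$, respectively). In fact, the branch $g$ has two extensions $g_1,g_2$ such that for every $z_2\in V$ with $d(z_1,a)\le d(z_2,a)\le\lambda r$ (or every $z_1\in V$ with $d(z_1,a)\le d(z_2,a)$, respectively), $(\star)$ holds for $g=g_1$ or $g=g_2$.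
   Context: $d$ is the distance on $\overline{\mathbb C}$ for the spherical metric $ds=\frac{2\,dz}{1+|z|^2}$, and $g^*$ is the derivative of a holomorphic map $g$ in this metric: $|g^*(z)|=\frac{(1+|z|^2)|g'(z)|}{1+|g(z)|^2}$. Logarithmic tract: let $U\subset\mathbb C$ be an unbounded simply connected domain whose boundary in $\mathbb C$ is a smooth open simple arc, let $a\in\overline{\mathbb C}$ and $0<r<\mathrm{diam}_{sph}\overline{\mathbb C}$. If $f:\overline U\to\mathbb C$ is continuous, holomorphic on $U$, $d(f(z),a)=r$ for every $z$ in the boundary of $U$, and $f$ on $U$ is a universal covering of $\{z:0<d(z,a)<r\}$, then $U$ is called a logarithmic tract of $f$ over $a$. An extension of a branch $g$ of $f^{-1}$ means an analytic continuation of $g$ as a branch of $f^{-1}$ (in $V$). *)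

theory Defs
  imports "HOL-Complex_Analysis.Complex_Analysis"
begin

section \<open>The Riemann sphere with the spherical metric\<close>

datatype csphere = Fin complex | Infty

fun stereo :: "csphere \<Rightarrow> complex \<times> real" where
  "stereo (Fin z) = (of_real (2 / (1 + (cmod z)\<^sup>2)) * z, ((cmod z)\<^sup>2 - 1) / (1 + (cmod z)\<^sup>2))"
| "stereo Infty = (0, 1)"

lemma norm_stereo: "norm (stereo x) = 1"
proof (cases x)
  case (Fin z)
  define s where "s = (cmod z)\<^sup>2"
  have s: "1 + s > 0" unfolding s_def by (smt (verit) zero_le_power2)
  have "(2 / (1 + s))\<^sup>2 * s + ((s - 1) / (1 + s))\<^sup>2 = (4 * s + (s - 1)\<^sup>2) / (1 + s)\<^sup>2"
    by (simp add: power_divide add_divide_distrib)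
  also have "4 * s + (s - 1)\<^sup>2 = (1 + s)\<^sup>2"
    by (simp add: power2_eq_square algebra_simps)
  finally have "(2 / (1 + s))\<^sup>2 * s + ((s - 1) / (1 + s))\<^sup>2 = 1"
    using s by simp
  then show ?thesis
    unfolding Fin by (simp add: norm_prod_def norm_mult norm_divide power_mult_distrib
        power_divide s_def flip: of_real_power of_real_add)
qed (simp add: norm_prod_def)

lemma stereo_inject: "stereo x = stereo y \<longleftrightarrow> x = y"
proof
  have ne: "((cmod z)\<^sup>2 - 1) / (1 + (cmod z)\<^sup>2) \<noteq> 1" for z
  proof
    assume "((cmod z)\<^sup>2 - 1) / (1 + (cmod z)\<^sup>2) = 1"
    then have "(cmod z)\<^sup>2 - 1 = 1 + (cmod z)\<^sup>2" by (metis div_by_1 divide_eq_1_iff)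
    then show False by linarith
  qed
  assume eq: "stereo x = stereo y"
  show "x = y"
  proof (cases x; cases y)
    fix z w assume xy: "x = Fin z" "y = Fin w"
    define s t where "s = (cmod z)\<^sup>2" and "t = (cmod w)\<^sup>2"
    have pos: "1 + s > 0" "1 + t > 0" unfolding s_def t_def by (smt (verit) zero_le_power2)+
    have "(s - 1) / (1 + s) = (t - 1) / (1 + t)"
      using eq xy by (simp add: s_def t_def)
    then have st: "s = t" using pos by (simp add: divide_simps) (simp add: algebra_simps)
    have "of_real (2 / (1 + s)) * z = of_real (2 / (1 + t)) * w"
      using eq xy by (simp add: s_def t_def)
    moreover have "complex_of_real (2 / (1 + t)) \<noteq> 0"
      using pos by (simp del: of_real_divide)
    ultimately show "x = y" using xy st by (metis mult_left_cancel)
  qed (use eq ne in \<open>auto simp: eq_commute[of 1]\<close>)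
qed simp

lemma arccos_inner_triangle:
  fixes x y z :: "'a::real_inner"
  assumes n: "norm x = 1" "norm y = 1" "norm z = 1"
  shows "arccos (x \<bullet> z) \<le> arccos (x \<bullet> y) + arccos (y \<bullet> z)"
proof -
  have b: "- 1 \<le> u \<bullet> v \<and> u \<bullet> v \<le> 1" if "norm u = 1" "norm v = 1" for u v :: 'a
    using Cauchy_Schwarz_ineq2[of u v] that by auto
  define p q where "p = x \<bullet> y" and "q = y \<bullet> z"
  have pq: "- 1 \<le> p" "p \<le> 1" "- 1 \<le> q" "q \<le> 1" using b n by (auto simp: p_def q_def)
  show ?thesis
  proof (cases "arccos p + arccos q \<le> pi")
    case False
    then show ?thesis using arccos_ubound b n p_def q_def by (smt (verit))
  next
    case True
    have unit: "x \<bullet> x = 1" "y \<bullet> y = 1" "z \<bullet> z = 1" using n by (simp_all add: norm_eq_1)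
    have nx: "norm (x - p *\<^sub>R y) = sqrt (1 - p\<^sup>2)"
      unfolding norm_eq_sqrt_inner
      by (simp add: inner_diff_left inner_diff_right unit p_def inner_commute power2_eq_square)
    have nz: "norm (z - q *\<^sub>R y) = sqrt (1 - q\<^sup>2)"
      unfolding norm_eq_sqrt_inner
      by (simp add: inner_diff_left inner_diff_right unit q_def inner_commute power2_eq_square)
    have "(x - p *\<^sub>R y) \<bullet> (z - q *\<^sub>R y) = x \<bullet> z - p * q"
      by (simp add: inner_diff_left inner_diff_right unit p_def q_def inner_commute)
    then have "x \<bullet> z - p * q \<ge> - (sqrt (1 - p\<^sup>2) * sqrt (1 - q\<^sup>2))"
      using Cauchy_Schwarz_ineq2[of "x - p *\<^sub>R y" "z - q *\<^sub>R y"] nx nz by auto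
    then have "cos (arccos p + arccos q) \<le> x \<bullet> z"
      using pq by (simp add: cos_add sin_arccos)
    then have "arccos (x \<bullet> z) \<le> arccos (cos (arccos p + arccos q))"
      using b[OF n(1) n(3)] by (intro arccos_le_arccos) auto
    also have "\<dots> = arccos p + arccos q"
      using True pq by (intro arccos_cos) (auto intro: add_nonneg_nonneg arccos_lbound)
    finally show ?thesis by (simp add: p_def q_def)
  qed
qed

text \<open>Stereographic projection carries \<open>ds = 2 |dz| / (1 + |z|\<^sup>2)\<close> to the round metric of the
  unit sphere, whose distance is the angle between unit vectors.\<close>

instantiation csphere :: metric_space
begin

definition dist_csphere :: "csphere \<Rightarrow> csphere \<Rightarrow> real" where
  "dist_csphere x y = arccos (stereo x \<bullet> stereo y)"

definition uniformity_csphere :: "(csphere \<times> csphere) filter" where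
  "uniformity_csphere = (INF e\<in>{0<..}. principal {(x, y). dist x y < e})"

definition open_csphere :: "csphere set \<Rightarrow> bool" where
  "open_csphere S = (\<forall>x\<in>S. \<forall>\<^sub>F (x', y) in uniformity. x' = x \<longrightarrow> y \<in> S)"

instance
proof
  fix x y z :: csphere
  have b: "\<bar>stereo x \<bullet> stereo y\<bar> \<le> 1"
    using Cauchy_Schwarz_ineq2[of "stereo x" "stereo y"] by (simp add: norm_stereo)
  show "dist x y = 0 \<longleftrightarrow> x = y"
  proof -
    have "dist x y = 0 \<longleftrightarrow> stereo x \<bullet> stereo y = 1"
      unfolding dist_csphere_def using b by (metis arccos_1 cos_arccos_abs cos_zero)
    also have "\<dots> \<longleftrightarrow> stereo x = stereo y"
    proof -
      have "(norm (stereo x - stereo y))\<^sup>2 = 2 - 2 * (stereo x \<bullet> stereo y)"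
        using dot_norm_neg[of "stereo x" "stereo y"] by (simp add: norm_stereo)
      then show ?thesis by auto
    qed
    finally show ?thesis by (simp add: stereo_inject)
  qed
  show "dist x y \<le> dist x z + dist y z"
    using arccos_inner_triangle[of "stereo x" "stereo z" "stereo y"]
    by (simp add: dist_csphere_def norm_stereo inner_commute)
qed (simp_all only: uniformity_csphere_def open_csphere_def)

end

lemma stereo_inner:
  "1 - stereo (Fin z) \<bullet> stereo (Fin w) = 2 * (cmod (z - w))\<^sup>2 / ((1 + (cmod z)\<^sup>2) * (1 + (cmod w)\<^sup>2))"
proof -
  define s t where "s = (cmod z)\<^sup>2" and "t = (cmod w)\<^sup>2"
  have pos: "1 + s > 0" "1 + t > 0" unfolding s_def t_def by (smt (verit) zero_le_power2)+
  have "stereo (Fin z) \<bullet> stereo (Fin w)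
      = 4 * (z \<bullet> w) / ((1 + s) * (1 + t)) + (s - 1) * (t - 1) / ((1 + s) * (1 + t))"
    by (simp add: inner_prod_def s_def t_def scaleR_conv_of_real[symmetric]
        flip: of_real_divide of_real_power of_real_add)
  then have inn: "stereo (Fin z) \<bullet> stereo (Fin w)
      = (4 * (z \<bullet> w) + (s - 1) * (t - 1)) / ((1 + s) * (1 + t))"
    by (simp only: add_divide_distrib)
  have "(1 + s) * (1 + t) \<noteq> 0" using pos by simp
  then have "1 - stereo (Fin z) \<bullet> stereo (Fin w)
      = ((1 + s) * (1 + t) - (4 * (z \<bullet> w) + (s - 1) * (t - 1))) / ((1 + s) * (1 + t))"
    unfolding inn by (metis diff_divide_distrib divide_self)
  also have "(1 + s) * (1 + t) - (4 * (z \<bullet> w) + (s - 1) * (t - 1)) = 2 * (cmod (z - w))\<^sup>2"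
    using dot_norm_neg[of z w] by (simp add: s_def t_def algebra_simps)
  finally show ?thesis by (simp only: s_def t_def)
qed

lemma arccos_half_angle:
  assumes "0 \<le> q" "q \<le> 1"
  shows "arccos (1 - 2 * q\<^sup>2) = 2 * arcsin q"
proof -
  have "cos (2 * arcsin q) = 1 - 2 * q\<^sup>2"
    using assms by (simp add: cos_double_sin)
  moreover have "0 \<le> 2 * arcsin q" "2 * arcsin q \<le> pi"
    using assms arcsin_bounded[of q] arcsin_le_arcsin[of 0 q] by auto
  ultimately show ?thesis using arccos_cos by metis
qed

lemma dist_Fin_Fin:
  "dist (Fin z) (Fin w) = 2 * arcsin (cmod (z - w) / (sqrt (1 + (cmod z)\<^sup>2) * sqrt (1 + (cmod w)\<^sup>2)))"
proof -
  define q where "q = cmod (z - w) / (sqrt (1 + (cmod z)\<^sup>2) * sqrt (1 + (cmod w)\<^sup>2))"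
  have q0: "0 \<le> q" by (simp add: q_def)
  have in2: "stereo (Fin z) \<bullet> stereo (Fin w) = 1 - 2 * q\<^sup>2"
    using stereo_inner[of z w] by (simp add: q_def power_divide power_mult_distrib)
  have "\<bar>stereo (Fin z) \<bullet> stereo (Fin w)\<bar> \<le> 1"
    using Cauchy_Schwarz_ineq2[of "stereo (Fin z)" "stereo (Fin w)"] by (simp only: norm_stereo)
  then have "q\<^sup>2 \<le> 1\<^sup>2" using in2 by simp
  then have "q \<le> 1" by (rule power2_le_imp_le) simp
  then show ?thesis
    using arccos_half_angle[OF q0] by (simp add: dist_csphere_def in2 q_def[symmetric] del: stereo.simps)
qed

lemma dist_Fin_Infty: "dist (Fin z) Infty = 2 * arcsin (1 / sqrt (1 + (cmod z)\<^sup>2))"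
proof -
  define q where "q = 1 / sqrt (1 + (cmod z)\<^sup>2)"
  have pos: "1 + (cmod z)\<^sup>2 > 0" by (smt (verit) zero_le_power2)
  have "stereo (Fin z) \<bullet> stereo Infty = 1 - 2 * q\<^sup>2"
    using pos by (simp add: inner_prod_def q_def power_divide field_simps)
  moreover have "0 \<le> q" "q \<le> 1" using pos by (auto simp: q_def divide_le_eq)
  ultimately show ?thesis
    using arccos_half_angle[of q] by (simp add: dist_csphere_def q_def[symmetric] del: stereo.simps)
qed


section \<open>Logarithmic tracts\<close>

text \<open>The punctured spherical disc \<open>V\<close>.\<close>

definition pdisc :: "csphere \<Rightarrow> real \<Rightarrow> csphere set" where
  "pdisc a r = {z. 0 < dist z a \<and> dist z a < r}"

text \<open>Smoothness is read as \<open>C\<^sup>1\<close> regularity. It only occurs as a hypothesis, so this also covers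
  \<open>C\<^sup>\<infinity>\<close> arcs.\<close>

definition smooth_open_arc :: "complex set \<Rightarrow> bool" where
  "smooth_open_arc A \<longleftrightarrow>
     (\<exists>\<gamma>::real \<Rightarrow> complex. \<gamma> C1_differentiable_on UNIV \<and>
        (\<forall>t. vector_derivative \<gamma> (at t) \<noteq> 0) \<and> (\<exists>h. homeomorphism UNIV A \<gamma> h))"

definition logarithmic_tract :: "(complex \<Rightarrow> complex) \<Rightarrow> complex set \<Rightarrow> csphere \<Rightarrow> real \<Rightarrow> bool" where
  "logarithmic_tract f U a r \<longleftrightarrow>
     0 < r \<and> r < diameter (UNIV :: csphere set) \<and>
     open U \<and> connected U \<and> simply_connected U \<and> \<not> bounded U \<and> smooth_open_arc (frontier U) \<and>
     continuous_on (closure U) f \<and> f holomorphic_on U \<and>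
     (\<forall>z\<in>frontier U. dist (Fin (f z)) a = r) \<and>
     covering_space U (\<lambda>z. Fin (f z)) (pdisc a r)"

text \<open>As \<open>f\<close> has finite values, points of \<open>V\<close> may be treated as complex numbers.\<close>

lemma logarithmic_tract_finite:
  assumes "logarithmic_tract f U a r"
  shows "Infty \<notin> pdisc a r"
  using covering_space_imp_surjective[of U "\<lambda>z. Fin (f z)" "pdisc a r"] assms
  by (auto simp: logarithmic_tract_def)


section \<open>Inverse branches\<close>

definition inverse_branch ::
  "(complex \<Rightarrow> complex) \<Rightarrow> complex set \<Rightarrow> complex set \<Rightarrow> (complex \<Rightarrow> complex) \<Rightarrow> bool" where
  "inverse_branch f U D g \<longleftrightarrow>
     open D \<and> g holomorphic_on D \<and> (\<forall>z\<in>D. g z \<in> U \<and> f (g z) = z)"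

text \<open>\<open>h\<close> on the domain \<open>D\<close> continues the germ of \<open>g\<close> at \<open>z\<close>. That \<open>D\<close> lies in \<open>V\<close> is automatic,
  since \<open>D = f ` h ` D\<close> and \<open>f ` U = V\<close>. Only germs have to agree: the neighbourhood on which
  \<open>g\<close> was given may, for instance, wind around \<open>a\<close>.\<close>

definition branch_extension ::
  "(complex \<Rightarrow> complex) \<Rightarrow> complex set \<Rightarrow> complex \<Rightarrow> (complex \<Rightarrow> complex) \<Rightarrow>
   complex set \<Rightarrow> (complex \<Rightarrow> complex) \<Rightarrow> bool" where
  "branch_extension f U z g D h \<longleftrightarrow>
     inverse_branch f U D h \<and> connected D \<and> z \<in> D \<and> (\<forall>\<^sub>F w in nhds z. h w = g w)"

definition sph_deriv :: "(complex \<Rightarrow> complex) \<Rightarrow> complex \<Rightarrow> real" where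
  "sph_deriv g z = (1 + (cmod z)\<^sup>2) * cmod (deriv g z) / (1 + (cmod (g z))\<^sup>2)"

definition distortion_bounds ::
  "real \<Rightarrow> csphere \<Rightarrow> (complex \<Rightarrow> complex) \<Rightarrow> complex \<Rightarrow> complex \<Rightarrow> bool" where
  "distortion_bounds c a g z1 z2 \<longleftrightarrow>
     (let d1 = dist (Fin z1) a; d2 = dist (Fin z2) a;
          q = sph_deriv g z1 / sph_deriv g z2
      in inverse c * (d2 / d1) * (ln (1 / d1) / ln (1 / d2)) powi (-3) \<le> q \<and>
         q \<le> c * (d2 / d1) * (ln (1 / d1) / ln (1 / d2)))"

end

theory Submission
  imports Defs
begin

unbundle no fps_syntax

text \<open>Rotate the sphere so that \<open>a\<close> becomes \<open>0\<close> and write \<open>w = R exp (- \<zeta>)\<close> with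
  \<open>R = tan (r / 2)\<close>. In the coordinate \<open>\<zeta>\<close> the branches of \<open>f\<^sup>-\<^sup>1\<close> are restrictions of one univalent
  map \<open>F\<close> of the right half-plane into \<open>U\<close>, which omits \<open>0\<close>, and \<open>Re \<zeta>\<close> is comparable to
  \<open>ln (1 / d(z, a))\<close>. Bieberbach's inequality for \<open>F\<close> and for \<open>1 / F\<close>, transplanted to the half-plane and
  averaged, bounds the logarithmic gradient \<open>Q\<close> of the spherical derivative of \<open>F\<close> by
  \<open>|x Q + 1| \<le> 2\<close>, where \<open>x = Re \<zeta>\<close>. Hence \<open>- 3 / x \<le> Re Q \<le> 1 / x\<close>, and integration along
  horizontal segments gives exactly the exponents \<open>- 3\<close> and \<open>1\<close>; vertical segments of bounded length only
  contribute to the constant.\<close>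

section \<open>Plane area in complex coordinates\<close>

text \<open>The exponents differ because the disc \<open>|x Q + 1| <= 2\<close> is centred at -1, a
  shift produced by the second derivative of the Moebius map from the disc to the half-plane. That 0
  lies outside \<open>U\<close> is what makes \<open>1 / F\<close> available: Bieberbach's
  inequality for \<open>F\<close> controls only \<open>F'' / F'\<close>, whereas \<open>Q\<close>
  also contains a multiple of \<open>F' / F\<close>, and a second univalent map is required to
  control it. The bound on \<open>Q\<close> degenerates at the imaginary axis;
  \<open>lam < 1\<close> keeps \<open>Re \<zeta>\<close> above \<open>ln (1 / lam)\<close>. The
  factor \<open>d(z2, a) / d(z1, a)\<close> is not distortion of \<open>F\<close>: it comes from the
  derivative of the exponential parametrisation. Circling \<open>a\<close> changes the branch, so an
  extension is built on the image of a strip of height \<open>2 * pi\<close>, where the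
  parametrisation is injective. In the area theorem, the area of the image of an annulus is computed
  in the coordinate \<open>ln z\<close>, bounded below by two Laurent modes, and bounded above by
  the area of an ellipse.\<close>

definition vec_of_complex :: "complex \<Rightarrow> real^2" where
  "vec_of_complex z = vector [Re z, Im z]"

text \<open>The change of variables formula speaks of \<open>det (matrix f')\<close> on
  \<open>real^2\<close>; this pair of maps moves the complex plane there and back.\<close>

definition complex_of_vec :: "real^2 \<Rightarrow> complex" where
  "complex_of_vec x = Complex (x $ 1) (x $ 2)"

lemma vec_of_complex_nth [simp]: "vec_of_complex z $ 1 = Re z" "vec_of_complex z $ 2 = Im z"
  by (simp_all add: vec_of_complex_def)

lemma complex_of_vec_sel [simp]: "Re (complex_of_vec x) = x $ 1" "Im (complex_of_vec x) = x $ 2"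
  by (simp_all add: complex_of_vec_def)

lemma complex_of_vec_of_complex [simp]: "complex_of_vec (vec_of_complex z) = z"
  by (simp add: complex_eq_iff)

lemma vec_of_complex_of_vec [simp]: "vec_of_complex (complex_of_vec x) = x"
  by (simp add: vec_eq_iff forall_2)

lemma inj_vec_of_complex: "inj vec_of_complex"
  by (metis complex_of_vec_of_complex injI)

lemma bounded_linear_vec_of_complex: "bounded_linear vec_of_complex"
  by (intro linear_conv_bounded_linear[THEN iffD1] linearI) (auto simp: vec_eq_iff forall_2)

lemma bounded_linear_complex_of_vec: "bounded_linear complex_of_vec"
  by (intro linear_conv_bounded_linear[THEN iffD1] linearI) (auto simp: complex_eq_iff)

lemma norm_vec_of_complex: "norm (vec_of_complex z) = cmod z"
  by (simp add: norm_vec_def L2_set_def sum_2 cmod_def)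

text \<open>Every real-linear map of the plane has this form. The case \<open>c = 0\<close> is the
  Jacobian \<open>|a|^2\<close> of a holomorphic map, the case \<open>a = 1\<close> the area factor
  of the map \<open>L\<close> in \<open>area_inequality\<close>.\<close>

lemma det_real_linear_complex:
  "det (matrix (\<lambda>x. vec_of_complex (a * complex_of_vec x + c * cnj (complex_of_vec x))))
     = (cmod a)\<^sup>2 - (cmod c)\<^sup>2"
  by (simp add: det_2 matrix_def axis_def cmod_power2) (simp add: power2_eq_square algebra_simps)

text \<open>\<open>g\<close> and \<open>h\<close> identify \<open>real^2\<close> with pairs and
  preserve boxes and their contents, so the integral carries over with factor 1 and Fubini's theorem
  for continuous functions on a product box applies.\<close>

lemma integral_vec2_eq_iterated:
  fixes f :: "real \<Rightarrow> real \<Rightarrow> real"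
  assumes "continuous_on (cbox (a, c) (b, d)) (\<lambda>(s, t). f s t)"
  shows "((\<lambda>x::real^2. f (x $ 1) (x $ 2)) has_integral
     integral {a..b} (\<lambda>s. integral {c..d} (f s))) (cbox (vector [a, c]) (vector [b, d]))"
proof -
  define g :: "real^2 \<Rightarrow> real \<times> real" where "g x = (x $ 1, x $ 2)" for x
  define h :: "real \<times> real \<Rightarrow> real^2" where "h p = vector [fst p, snd p]" for p
  have hg: "h (g x) = x" for x by (simp add: g_def h_def vec_eq_iff forall_2)
  have gh: "g (h x) = x" for x by (simp add: g_def h_def)
  have gim: "g ` cbox u v = cbox (g u) (g v)" for u v
  proof -
    have *: "x \<in> cbox u v \<longleftrightarrow> g x \<in> cbox (g u) (g v)" for x
      by (auto simp: g_def mem_box_cart cbox_Pair_iff forall_2)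
    then have "h y \<in> cbox u v" if "y \<in> cbox (g u) (g v)" for y using that by (simp add: gh)
    then show ?thesis using * gh by (auto simp: image_iff) (metis gh)
  qed
  have him: "h ` cbox u v = cbox (h u) (h v)" for u v
  proof -
    have "h ` g ` cbox (h u) (h v) = cbox (h u) (h v)" by (simp add: image_image hg)
    then show ?thesis by (simp only: gim gh)
  qed
  have cont: "measure lborel (g ` cbox u v) = 1 * measure lborel (cbox u v)" for u v
  proof -
    have "measure lborel (cbox (g u) (g v)) = measure lborel (cbox (u$1) (v$1)) * measure lborel (cbox (u$2) (v$2))"
      by (simp add: g_def content_Pair)
    also have "\<dots> = measure lborel (cbox u v)"
    proof (cases "u $ 1 \<le> v $ 1 \<and> u $ 2 \<le> v $ 2")
      case True
      then have "cbox u v \<noteq> {}" by (auto simp: interval_ne_empty_cart forall_2)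
      then show ?thesis using True by (simp add: content_cbox_cart UNIV_2)
    next
      case False
      then have "cbox u v = {}" by (auto simp: interval_eq_empty_cart not_le)
      then show ?thesis using False by auto
    qed
    finally show ?thesis by (simp add: gim)
  qed
  have int: "((\<lambda>(s, t). f s t) has_integral integral (cbox (a, c) (b, d)) (\<lambda>(s, t). f s t)) (cbox (a, c) (b, d))"
    using assms integrable_continuous by blast
  have "((\<lambda>x. (\<lambda>(s, t). f s t) (g x)) has_integral (1 / 1) *\<^sub>R integral (cbox (a, c) (b, d)) (\<lambda>(s, t). f s t)) (h ` cbox (a, c) (b, d))"
  proof (rule has_integral_twiddle[OF _ hg gh _ _ _ cont int])
    show "isCont g x" for x unfolding g_def by (intro continuous_intros)
  qed (use gim him in \<open>blast | simp\<close>)+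
  then show ?thesis
    using integral_prod_continuous[OF assms] by (simp add: him) (simp add: g_def h_def)
qed

section \<open>Laurent modes on circles and areas in logarithmic coordinates\<close>

lemma cmod_add_square: "(cmod (u + w))\<^sup>2 = (cmod u)\<^sup>2 + (cmod w)\<^sup>2 + 2 * Re (cnj u * w)"
  unfolding cmod_power2 by (simp add: power2_eq_square algebra_simps)

text \<open>\<open>N\<close> has a primitive \<open>P\<close> on the disc, and the integrand is the
  derivative in \<open>t\<close> of \<open>- \<i> * P (exp (Complex s t))\<close>, which has period
  \<open>2 * pi\<close>.\<close>

lemma integral_circle_times_holomorphic:
  assumes N: "N holomorphic_on ball 0 1" and s: "s < 0"
  shows "((\<lambda>t. exp (Complex s t) * N (exp (Complex s t))) has_integral 0) {0..2*pi}"
proof -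
  obtain P where P: "\<And>z. z \<in> ball 0 1 \<Longrightarrow> (P has_field_derivative N z) (at z)"
    using holomorphic_convex_primitive'[OF convex_ball open_ball N] by (metis at_within_open open_ball)
  have ball: "exp (Complex s t) \<in> ball 0 1" for t using s by simp
  have C: "Complex s t = of_real s + \<i> * of_real t" for t by (simp add: complex_eq_iff)
  have vd: "((\<lambda>t. - \<i> * P (exp (Complex s t))) has_vector_derivative exp (Complex s t) * N (exp (Complex s t))) (at t within {0..2*pi})" for t
  proof -
    have "((\<lambda>x. Complex s x) has_vector_derivative \<i>) (at t within {0..2*pi})"
      unfolding C by (auto intro!: derivative_eq_intros simp: has_vector_derivative_def fun_eq_iff scaleR_conv_of_real)
    moreover have "((\<lambda>z. - \<i> * P (exp z)) has_field_derivative - \<i> * (N (exp (Complex s t)) * exp (Complex s t))) (at (Complex s t))"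
      by (intro DERIV_cmult DERIV_chain2[where f = P] P ball DERIV_exp)
    ultimately have "((\<lambda>z. - \<i> * P (exp z)) \<circ> (\<lambda>x. Complex s x) has_vector_derivative \<i> * (- \<i> * (N (exp (Complex s t)) * exp (Complex s t)))) (at t within {0..2*pi})"
      by (intro field_vector_diff_chain_within) (auto intro: has_field_derivative_at_within)
    then show ?thesis by (simp add: o_def mult.commute)
  qed
  have "exp (Complex s (2*pi)) = exp (Complex s 0)"
    by (simp add: C exp_add exp_eq_1)
  then show ?thesis
    using fundamental_theorem_of_calculus[of 0 "2*pi" "\<lambda>t. - \<i> * P (exp (Complex s t))", OF _ vd] by simp
qed

text \<open>Bessel's inequality: only the modes \<open>-1\<close> and \<open>1\<close> of the Laurent series are retained.\<close>

lemma integral_circle_norm_square_ge: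
  fixes b :: complex
  assumes m: "m holomorphic_on ball 0 1" and s: "s < 0"
  defines "q \<equiv> \<lambda>z. - (1 / z) + b * z + z\<^sup>2 * m z"
  shows "2 * pi * (exp (- 2 * s) + (cmod b)\<^sup>2 * exp (2 * s)) \<le> integral {0..2*pi} (\<lambda>t. (cmod (q (exp (Complex s t))))\<^sup>2)"
proof -
  define \<rho> where "\<rho> = exp s"
  have \<rho>: "\<rho> > 0" by (simp add: \<rho>_def)
  \<comment> \<open>On \<open>|z| = \<rho>\<close> the relation \<open>cnj z = \<rho>^2 / z\<close>
    turns the sum of all cross terms of \<open>|q|^2\<close> into twice the real part of
    \<open>z * N z\<close> with \<open>N\<close> holomorphic, which has mean zero. The square of the
    tail \<open>z^2 * m z\<close> is dropped.\<close>
  define N where "N z = - (b * z) / of_real (\<rho>\<^sup>2) - z\<^sup>2 * m z / of_real (\<rho>\<^sup>2) + cnj b * of_real (\<rho>\<^sup>2) * m z" for z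
  have N: "N holomorphic_on ball 0 1"
    unfolding N_def using \<rho> by (intro holomorphic_intros m) auto
  define E where "E t = exp (Complex s t)" for t
  have E: "cmod (E t) = \<rho>" for t by (simp add: E_def \<rho>_def)
  have Eb: "E t \<in> ball 0 1" for t using s by (simp add: E_def)
  have lower: "1 / \<rho>\<^sup>2 + (cmod b)\<^sup>2 * \<rho>\<^sup>2 + 2 * Re (E t * N (E t)) \<le> (cmod (q (E t)))\<^sup>2" for t
  proof -
    define z where "z = E t"
    have z0: "z \<noteq> 0" and zc: "z * cnj z = of_real (\<rho>\<^sup>2)" 
      using E[of t] \<rho> complex_norm_square[of z] by (auto simp: z_def)
    have cz: "cnj z = of_real (\<rho>\<^sup>2) / z" using z0 zc by (simp add: field_simps)
    define u w where "u = - (1 / z) + b * z" and "w = z\<^sup>2 * m z"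
    have "(cmod (u + w))\<^sup>2 = (cmod u)\<^sup>2 + (cmod w)\<^sup>2 + 2 * Re (cnj u * w)"
      by (rule cmod_add_square)
    moreover have "(cmod u)\<^sup>2 = 1 / \<rho>\<^sup>2 + (cmod b)\<^sup>2 * \<rho>\<^sup>2 - 2 * Re (b * z\<^sup>2 / of_real (\<rho>\<^sup>2))"
    proof -
      have "(cmod u)\<^sup>2 = (cmod (1 / z))\<^sup>2 + (cmod (b * z))\<^sup>2 - 2 * Re (cnj (1 / z) * (b * z))"
        unfolding u_def using cmod_add_square[of "- (1 / z)" "b * z"] by (simp add: norm_divide)
      also have "cnj (1 / z) * (b * z) = b * z\<^sup>2 / of_real (\<rho>\<^sup>2)"
        using z0 \<rho> by (simp add: cz power2_eq_square field_simps)
      finally show ?thesis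
        using E[of t] by (simp add: norm_mult norm_divide power_divide power_mult_distrib z_def)
    qed
    moreover have "cnj u * w - b * z\<^sup>2 / of_real (\<rho>\<^sup>2) = z * N z"
      unfolding u_def w_def N_def using z0 \<rho> 
      by (simp add: cz field_simps power2_eq_square)
    then have "Re (cnj u * w) - Re (b * z\<^sup>2 / of_real (\<rho>\<^sup>2)) = Re (z * N z)"
      by (metis minus_complex.simps(1))
    ultimately have "1 / \<rho>\<^sup>2 + (cmod b)\<^sup>2 * \<rho>\<^sup>2 + 2 * Re (z * N z) \<le> (cmod (u + w))\<^sup>2"
      using zero_le_power2[of "cmod w"] by linarith
    then show ?thesis by (simp add: q_def u_def w_def z_def)
  qed
  have iN: "((\<lambda>t. Re (E t * N (E t))) has_integral 0) {0..2*pi}"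
    using has_integral_Re[OF integral_circle_times_holomorphic[OF N s]] by (simp add: E_def)
  have "((\<lambda>t. 1 / \<rho>\<^sup>2 + (cmod b)\<^sup>2 * \<rho>\<^sup>2 + 2 * Re (E t * N (E t))) has_integral
      (2*pi) * (1 / \<rho>\<^sup>2 + (cmod b)\<^sup>2 * \<rho>\<^sup>2) + 2 * 0) {0..2*pi}"
    using has_integral_const_real[of "1 / \<rho>\<^sup>2 + (cmod b)\<^sup>2 * \<rho>\<^sup>2" 0 "2*pi"]
    by (intro has_integral_add has_integral_mult_right iN) simp
  moreover have "continuous_on {0..2*pi} (\<lambda>t. (cmod (q (E t)))\<^sup>2)"
  proof -
    have cE: "continuous_on {0..2*pi} E"
      unfolding E_def Complex_eq by (intro continuous_intros)
    have "continuous_on (ball 0 1 - {0}) q"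
      unfolding q_def by (intro continuous_intros holomorphic_on_imp_continuous_on holomorphic_on_subset[OF m]) auto
    then have "continuous_on {0..2*pi} (\<lambda>t. q (E t))"
      by (rule continuous_on_compose2[OF _ cE]) (use Eb in \<open>auto simp: E_def\<close>)
    then show ?thesis by (intro continuous_intros)
  qed
  then have "((\<lambda>t. (cmod (q (E t)))\<^sup>2) has_integral integral {0..2*pi} (\<lambda>t. (cmod (q (E t)))\<^sup>2)) {0..2*pi}"
    using integrable_continuous_interval by blast
  ultimately have "2 * pi * (1 / \<rho>\<^sup>2 + (cmod b)\<^sup>2 * \<rho>\<^sup>2) + 2 * 0 \<le> integral {0..2*pi} (\<lambda>t. (cmod (q (E t)))\<^sup>2)"
    using has_integral_le lower by blast
  moreover have "1 / \<rho>\<^sup>2 = exp (- 2 * s)" "\<rho>\<^sup>2 = exp (2 * s)"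
    by (simp_all add: \<rho>_def exp_minus field_simps flip: exp_of_nat_mult exp_double)
  ultimately show ?thesis by (simp add: E_def)
qed

text \<open>In the coordinate \<open>ln z\<close> an annulus becomes a rectangle and the Jacobian
  becomes \<open>|z G'(z)|^2\<close>. The open rectangle of height \<open>2 * pi\<close> covers a
  slit annulus exactly once, so injectivity of \<open>G\<close> passes to
  \<open>\<Psi>\<close>.\<close>

lemma measure_image_logarithmic_rectangle:
  assumes hol: "G holomorphic_on ball 0 1 - {0}" and inj: "inj_on G (ball 0 1 - {0})"
    and s: "s0 < s1" "s1 < 0"
  defines "R \<equiv> box (vector [s0, 0]) (vector [s1, 2 * pi]) :: (real^2) set"
    and "\<Psi> \<equiv> \<lambda>x. vec_of_complex (G (exp (complex_of_vec x)))"
    and "J \<equiv> \<lambda>s t. (cmod (exp (Complex s t) * deriv G (exp (Complex s t))))\<^sup>2"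
  shows "\<Psi> ` R \<in> lmeasurable"
    and "measure lebesgue (\<Psi> ` R) = integral {s0..s1} (\<lambda>s. integral {0..2*pi} (J s))"
    and "(\<lambda>s. integral {0..2*pi} (J s)) integrable_on {s0..s1}"
proof -
  have contJ: "continuous_on (cbox (s0, 0) (s1, 2*pi)) (\<lambda>(s, t). J s t)"
  proof -
    have "continuous_on (ball 0 1 - {0}) (\<lambda>z. (cmod (z * deriv G z))\<^sup>2)"
      by (intro continuous_intros holomorphic_on_imp_continuous_on holomorphic_deriv hol open_delete) auto
    then show ?thesis
      unfolding J_def case_prod_unfold
      by (rule continuous_on_compose2)
        (use s in \<open>auto simp: Complex_eq intro!: continuous_intros\<close>)
  qed
  define f' where "f' x = (\<lambda>h. vec_of_complex (exp (complex_of_vec x) * deriv G (exp (complex_of_vec x)) * complex_of_vec h))" for x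
  have memR: "x \<in> R \<longleftrightarrow> s0 < x $ 1 \<and> x $ 1 < s1 \<and> 0 < x $ 2 \<and> x $ 2 < 2 * pi" for x
    by (auto simp: R_def mem_box_cart forall_2)
  have dom: "exp (complex_of_vec x) \<in> ball 0 1 - {0}" if "x \<in> R" for x
    using that s by (auto simp: memR)
  have der: "(\<Psi> has_derivative f' x) (at x within R)" if x: "x \<in> R" for x
  proof -
    let ?z = "complex_of_vec x"
    have "(G has_field_derivative deriv G (exp ?z)) (at (exp ?z))"
      by (rule holomorphic_derivI[OF hol _ dom[OF x]]) (simp add: open_delete)
    then have "((\<lambda>z. G (exp z)) has_field_derivative deriv G (exp ?z) * exp ?z) (at ?z)"
      by (rule DERIV_chain2) (rule DERIV_exp)
    then have "((\<lambda>z. G (exp z)) has_derivative (*) (exp ?z * deriv G (exp ?z))) (at ?z)"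
      by (simp add: has_field_derivative_def mult.commute)
    then have "((\<lambda>x. G (exp (complex_of_vec x))) has_derivative (\<lambda>h. exp ?z * deriv G (exp ?z) * complex_of_vec h)) (at x within R)"
      by (rule has_derivative_compose[rotated])
        (rule bounded_linear_imp_has_derivative[OF bounded_linear_complex_of_vec])
    then show ?thesis
      unfolding \<Psi>_def f'_def
      by (rule bounded_linear.has_derivative[OF bounded_linear_vec_of_complex])
  qed
  have detJ: "\<bar>det (matrix (f' x))\<bar> = J (x $ 1) (x $ 2)" for x
    using det_real_linear_complex[of "exp (complex_of_vec x) * deriv G (exp (complex_of_vec x))" 0]
    by (simp add: f'_def J_def complex_of_vec_def)
  have injR: "inj_on \<Psi> R"
  proof (rule inj_onI)
    fix x y assume xy: "x \<in> R" "y \<in> R" "\<Psi> x = \<Psi> y"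
    then have "G (exp (complex_of_vec x)) = G (exp (complex_of_vec y))"
      unfolding \<Psi>_def by (meson inj_vec_of_complex injD)
    then have e: "exp (complex_of_vec x) = exp (complex_of_vec y)"
      using inj_onD[OF inj] dom xy by blast
    have "\<bar>Im (complex_of_vec x) - Im (complex_of_vec y)\<bar> < 2 * pi"
      using xy by (auto simp: memR)
    then have "complex_of_vec x = complex_of_vec y"
      using e exp_complex_eqI by blast
    then show "x = y" by (metis vec_of_complex_of_vec)
  qed
  have intR: "((\<lambda>x. \<bar>det (matrix (f' x))\<bar>) has_integral integral {s0..s1} (\<lambda>s. integral {0..2*pi} (J s))) R"
    unfolding R_def has_integral_open_interval detJ
    by (rule integral_vec2_eq_iterated[OF contJ])
  have Rleb: "R \<in> sets lebesgue" by (simp add: R_def)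
  show "\<Psi> ` R \<in> lmeasurable"
    using measurable_differentiable_image_eq[OF Rleb der injR] intR by blast
  show "measure lebesgue (\<Psi> ` R) = integral {s0..s1} (\<lambda>s. integral {0..2*pi} (J s))"
    using measure_differentiable_image_eq[OF Rleb der injR has_integral_integrable[OF intR]]
      integral_unique[OF intR] by (simp only:)
  show "(\<lambda>s. integral {0..2*pi} (J s)) integrable_on {s0..s1}"
    using integral_integrable_2dim[OF contJ] by simp
qed

text \<open>The expression inside \<open>J\<close> is \<open>z G'(z)\<close> for a map
  \<open>G\<close> with principal part \<open>1 / z\<close>, whence the minus sign. The bound for
  each circle is integrated over the logarithm of the radius.\<close>

lemma area_logarithmic_rectangle_ge:
  fixes b :: complex
  assumes s: "s0 < s1" "s1 < 0" and m: "m holomorphic_on ball 0 1"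
    and J: "\<And>s t. s < 0 \<Longrightarrow> J s t = (cmod (- (1 / exp (Complex s t)) + b * exp (Complex s t) + (exp (Complex s t))\<^sup>2 * m (exp (Complex s t))))\<^sup>2"
    and int: "(\<lambda>s. integral {0..2*pi} (J s)) integrable_on {s0..s1}"
  shows "pi * (exp (- 2 * s0) - exp (- 2 * s1)) + pi * (cmod b)\<^sup>2 * (exp (2 * s1) - exp (2 * s0))
     \<le> integral {s0..s1} (\<lambda>s. integral {0..2*pi} (J s))"
proof -
  have "((\<lambda>s. 2 * pi * (exp (- 2 * s) + (cmod b)\<^sup>2 * exp (2 * s))) has_integral
     (- pi * exp (- 2 * s1) + pi * (cmod b)\<^sup>2 * exp (2 * s1)) - (- pi * exp (- 2 * s0) + pi * (cmod b)\<^sup>2 * exp (2 * s0))) {s0..s1}"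
    by (rule fundamental_theorem_of_calculus)
      (use s in \<open>auto intro!: derivative_eq_intros simp: algebra_simps simp flip: has_real_derivative_iff_has_vector_derivative\<close>)
  moreover have "2 * pi * (exp (- 2 * s) + (cmod b)\<^sup>2 * exp (2 * s)) \<le> integral {0..2*pi} (J s)"
    if "s \<in> {s0..s1}" for s
  proof -
    have neg: "s < 0" using that s by simp
    have Js: "J s = (\<lambda>t. (cmod (- (1 / exp (Complex s t)) + b * exp (Complex s t) + (exp (Complex s t))\<^sup>2 * m (exp (Complex s t))))\<^sup>2)"
      using J neg by blast
    show ?thesis unfolding Js by (rule integral_circle_norm_square_ge[OF m neg])
  qed
  ultimately have "(- pi * exp (- 2 * s1) + pi * (cmod b)\<^sup>2 * exp (2 * s1)) - (- pi * exp (- 2 * s0) + pi * (cmod b)\<^sup>2 * exp (2 * s0))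
     \<le> integral {s0..s1} (\<lambda>s. integral {0..2*pi} (J s))"
    using has_integral_le int integrable_integral by blast
  then show ?thesis by (simp add: algebra_simps)
qed


text \<open>The complement of \<open>S\<close> is connected, and the pole sends points of the small
  punctured disc into it. Outside \<open>S\<close> the image of this punctured disc is both open and
  relatively closed, hence it is everything; by injectivity no point on or outside the circle can be
  mapped outside \<open>S\<close>.\<close>

lemma image_outside_circle_subset:
  fixes S :: "complex set"
  assumes cont: "continuous_on (ball 0 1 - {0}) G" and inj: "inj_on G (ball 0 1 - {0})"
    and pole: "filterlim G at_infinity (at 0)" and eps: "0 < \<epsilon>" "\<epsilon> < 1"
    and S: "compact S" "convex S" and circ: "\<And>z. cmod z = \<epsilon> \<Longrightarrow> G z \<in> S"
    and z: "\<epsilon> \<le> cmod z" "cmod z < 1"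
  shows "G z \<in> S"
proof (rule ccontr)
  define P where "P = ball (0::complex) \<epsilon> - {0}"
  define Q where "Q = cball (0::complex) \<epsilon> - {0}"
  assume "G z \<notin> S"
  have Psub: "P \<subseteq> ball 0 1 - {0}" and Qsub: "Q \<subseteq> ball 0 1 - {0}"
    using eps by (auto simp: P_def Q_def)
  have "open (G ` P)"
    using invariance_of_domain[of P G] continuous_on_subset[OF cont Psub] inj_on_subset[OF inj Psub]
    by (simp add: P_def open_delete)
  \<comment> \<open>A sequence in \<open>Q\<close> has a convergent subsequence; its limit cannot be
    0, where \<open>G\<close> tends to infinity, so it lies in \<open>Q\<close> again.\<close>
  have "closed (G ` Q)"
    unfolding closed_sequential_limits
  proof (intro allI impI, elim conjE)
    fix w l assume w: "\<forall>n. w n \<in> G ` Q" and l: "w \<longlonglongrightarrow> l"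
    then have "\<forall>n. \<exists>x. x \<in> Q \<and> w n = G x" by blast
    then obtain u where u: "\<And>n. u n \<in> Q" "\<And>n. w n = G (u n)" by metis
    have "\<forall>n. u n \<in> cball 0 \<epsilon>" using u by (auto simp: Q_def)
    then obtain v r where v: "v \<in> cball 0 \<epsilon>" "strict_mono (r :: nat \<Rightarrow> nat)" "(u \<circ> r) \<longlonglongrightarrow> v"
      by (rule seq_compactE[OF compact_imp_seq_compact[OF compact_cball]])
    have lim: "(\<lambda>n. G ((u \<circ> r) n)) \<longlonglongrightarrow> l"
      using LIMSEQ_subseq_LIMSEQ[OF l v(2)] by (simp add: o_def u(2))
    have "v \<noteq> 0"
    proof
      assume "v = 0"
      then have "filterlim (u \<circ> r) (at 0) sequentially"
        using v(3) u(1) by (auto simp: filterlim_at Q_def)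
      then have "filterlim (\<lambda>n. G ((u \<circ> r) n)) at_infinity sequentially"
        by (rule filterlim_compose[OF pole])
      then show False using lim not_tendsto_and_filterlim_at_infinity[of sequentially] by auto
    qed
    then have vQ: "v \<in> Q" using v by (simp add: Q_def)
    have "(\<lambda>n. G ((u \<circ> r) n)) \<longlonglongrightarrow> G v"
    proof (rule continuous_on_tendsto_compose[OF cont v(3)])
      have "(u \<circ> r) n \<in> ball 0 1 - {0}" for n using u(1)[of "r n"] Qsub by auto
      then show "\<forall>\<^sub>F n in sequentially. (u \<circ> r) n \<in> ball 0 1 - {0}" by (intro always_eventually allI)
    qed (use vQ Qsub in auto)
    then have "l = G v" using lim LIMSEQ_unique by blast
    then show "l \<in> G ` Q" using vQ by blast
  qed
  \<comment> \<open>\<open>Q\<close> and \<open>P\<close> differ only by the circle, which is mapped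
    into \<open>S\<close>.\<close>
  have eq: "G ` P \<inter> - S = G ` Q \<inter> - S"
    using circ by (force simp: P_def Q_def)
  have "connected (- S)"
    using connected_complement_bounded_convex[of S] S compact_imp_bounded by auto
  moreover have "\<exists>p\<in>P. G p \<notin> S"
  proof -
    obtain M where M: "\<And>y. y \<in> S \<Longrightarrow> cmod y \<le> M" 
      using compact_imp_bounded[OF S(1)] by (auto simp: bounded_iff)
    have "\<forall>\<^sub>F z in at 0. max M 1 < cmod (G z)"
      using pole unfolding filterlim_at_infinity_conv_norm_at_top filterlim_at_top_dense by (rule spec)
    then obtain d where d: "d > 0" "\<And>z. z \<noteq> 0 \<Longrightarrow> dist z 0 < d \<Longrightarrow> max M 1 < cmod (G z)"
      by (auto simp: eventually_at)
    define p where "p = complex_of_real (min d \<epsilon> / 2)"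
    have "p \<in> P" "p \<noteq> 0" "dist p 0 < d" using d eps by (auto simp: p_def P_def)
    then show ?thesis using d(2)[of p] M by force
  qed
  moreover have "G ` P \<inter> - (G ` Q) \<inter> - S = {}" "- S \<subseteq> G ` P \<union> - (G ` Q)"
    using eq by blast+
  moreover have "open (- (G ` Q))" using \<open>closed (G ` Q)\<close> by (simp add: open_Compl)
  ultimately have "- (G ` Q) \<inter> - S = {}"
    using connectedD[of "- S" "G ` P" "- (G ` Q)"] \<open>open (G ` P)\<close> by blast
  then have "- S \<subseteq> G ` P" using eq by blast
  then have "G z \<in> G ` P" using \<open>G z \<notin> S\<close> by auto
  then obtain p where p: "p \<in> P" "G p = G z" by (metis imageE)
  moreover have "p \<in> ball 0 1 - {0}" "z \<in> ball 0 1 - {0}" using p Psub z eps by auto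
  ultimately have "p = z" using inj_onD[OF inj] by blast
  then show False using p z by (simp add: P_def)
qed

section \<open>The area theorem\<close>

text \<open>On the circle \<open>|z| = \<epsilon>\<close> the map is, up to the error \<open>z\<^sup>2 k z\<close>, the real-linear map
  \<open>L \<zeta> = \<zeta> + b \<epsilon>\<^sup>2 cnj \<zeta>\<close> of \<open>\<zeta> = 1 / z\<close>. Since \<open>det L \<le> 1\<close>, enclosing the image of the annulus in
  the \<open>L\<close>-image of a disc costs only an error that tends to \<open>0\<close> with \<open>\<epsilon>\<close>; a round disc would be too
  large.\<close>

lemma area_inequality:
  fixes b :: complex
  assumes k: "k holomorphic_on ball 0 1" and K: "\<And>z. cmod z = \<epsilon> \<Longrightarrow> cmod (k z) \<le> K"
    and inj: "inj_on (\<lambda>z. 1 / z + b * z + z\<^sup>2 * k z) (ball 0 1 - {0})"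
    and eps: "0 < \<epsilon>" "\<epsilon> < \<rho>" "\<rho> < 1" and small: "cmod b * \<epsilon>\<^sup>2 \<le> 1 / 2"
  shows "(cmod b)\<^sup>2 * (\<rho>\<^sup>2 - \<epsilon>\<^sup>2) \<le> 1 / \<rho>\<^sup>2 + 4 * K * \<epsilon> + 4 * K\<^sup>2 * \<epsilon> ^ 4"
proof -
  define G where "G z = 1 / z + b * z + z\<^sup>2 * k z" for z
  define m where "m z = 2 * k z + z * deriv k z" for z
  have Ghol: "G holomorphic_on ball 0 1 - {0}"
    unfolding G_def by (intro holomorphic_intros holomorphic_on_subset[OF k]) auto
  have m: "m holomorphic_on ball 0 1"
    unfolding m_def by (intro holomorphic_intros k holomorphic_deriv) auto
  have Ginj: "inj_on G (ball 0 1 - {0})" using inj by (simp add: G_def[abs_def])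
  have K0: "0 \<le> K" using K[of "of_real \<epsilon>"] eps norm_ge_zero[of "k (of_real \<epsilon>)"]
    by (simp del: norm_ge_zero)
  have dG: "z * deriv G z = - (1 / z) + b * z + z\<^sup>2 * m z" if z: "z \<in> ball 0 1 - {0}" for z
  proof -
    have "(k has_field_derivative deriv k z) (at z)"
      using holomorphic_derivI[OF k open_ball] z by auto
    then have "(G has_field_derivative (- (1 / z\<^sup>2) + b + (2 * z * k z + z\<^sup>2 * deriv k z))) (at z)"
      unfolding G_def using z
      by (auto intro!: derivative_eq_intros simp: power2_eq_square field_simps)
    then have "deriv G z = - (1 / z\<^sup>2) + b + (2 * z * k z + z\<^sup>2 * deriv k z)" by (rule DERIV_imp_deriv)
    then show ?thesis using z by (simp add: m_def power2_eq_square field_simps)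
  qed
  define s0 s1 where "s0 = ln \<epsilon>" and "s1 = ln \<rho>"
  have s: "s0 < s1" "s1 < 0" using eps by (auto simp: s0_def s1_def)
  define R where "R = (box (vector [s0, 0]) (vector [s1, 2 * pi]) :: (real^2) set)"
  define \<Psi> where "\<Psi> x = vec_of_complex (G (exp (complex_of_vec x)))" for x
  define J where "J s t = (cmod (exp (Complex s t) * deriv G (exp (Complex s t))))\<^sup>2" for s t
  note rect = measure_image_logarithmic_rectangle[OF Ghol Ginj s, folded R_def \<Psi>_def J_def]
  have Jeq: "J s t = (cmod (- (1 / exp (Complex s t)) + b * exp (Complex s t) + (exp (Complex s t))\<^sup>2 * m (exp (Complex s t))))\<^sup>2" if "s < 0" for s t
    using dG[of "exp (Complex s t)"] that unfolding J_def by simp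
  define L where "L \<zeta> = \<zeta> + b * of_real (\<epsilon>\<^sup>2) * cnj \<zeta>" for \<zeta>
  \<comment> \<open>\<open>1 / \<epsilon>\<close> is the modulus of \<open>1 / z\<close> on the
    circle; \<open>2 * K * \<epsilon>^2\<close> bounds the preimage under \<open>L\<close> of the
    error \<open>z^2 * k z\<close>, because \<open>L\<close> shrinks lengths by at most the factor
    2.\<close>
  define r where "r = 1 / \<epsilon> + 2 * K * \<epsilon>\<^sup>2"
  have r0: "0 \<le> r" using eps K0 by (simp add: r_def)
  define V where "V = (\<lambda>x. vec_of_complex (L (complex_of_vec x)))"
  have blV: "bounded_linear V"
    unfolding V_def L_def
    by (intro bounded_linear_compose[OF bounded_linear_vec_of_complex] bounded_linear_add bounded_linear_complex_of_vec
        bounded_linear_compose[OF bounded_linear_mult_right]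
        bounded_linear_compose[OF bounded_linear_cnj])
  have detV: "det (matrix V) = 1 - (cmod (b * of_real (\<epsilon>\<^sup>2)))\<^sup>2"
    using det_real_linear_complex[of 1 "b * of_real (\<epsilon>\<^sup>2)"] by (simp add: V_def L_def)
  have c2: "cmod (b * of_real (\<epsilon>\<^sup>2)) \<le> 1 / 2" using small by (simp add: norm_mult norm_power)
  have Llow: "cmod \<zeta> \<le> 2 * cmod (L \<zeta>)" for \<zeta>
  proof -
    have "cmod (b * of_real (\<epsilon>\<^sup>2) * cnj \<zeta>) \<le> 1 / 2 * cmod \<zeta>"
      unfolding norm_mult[of "b * of_real (\<epsilon>\<^sup>2)"] using c2 by (intro mult_mono) auto
    then show ?thesis
      using norm_triangle_ineq4[of "L \<zeta>" "b * of_real (\<epsilon>\<^sup>2) * cnj \<zeta>"] by (simp add: L_def)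
  qed
  have blL: "bounded_linear L"
    unfolding L_def
    by (intro bounded_linear_add bounded_linear_ident bounded_linear_compose[OF bounded_linear_mult_right] bounded_linear_cnj)
  have "\<zeta> = 0" if "L \<zeta> = 0" for \<zeta> using Llow[of \<zeta>] that by simp
  then have "inj L"
    by (simp add: linear_injective_0[OF bounded_linear.linear[OF blL]])
  then have "surj L"
    using linear_injective_imp_surjective[OF bounded_linear.linear[OF blL]] by simp
  have circ: "G z \<in> L ` cball 0 r" if z: "cmod z = \<epsilon>" for z
  proof -
    obtain \<eta> where \<eta>: "L \<eta> = z\<^sup>2 * k z" using \<open>surj L\<close> by (metis surjD)
    have z0: "z \<noteq> 0" using z eps by auto
    \<comment> \<open>Because of this relation the real-linear map \<open>L\<close> sends
      \<open>1 / z\<close> exactly to \<open>1 / z + b * z\<close> on the circle.\<close>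
    have e: "of_real (\<epsilon>\<^sup>2) * cnj (1 / z) = z"
      using complex_norm_square[of z] z z0 by (simp add: field_simps)
    have "L (1 / z) = 1 / z + b * z" unfolding L_def mult.assoc e by (rule refl)
    then have "G z = L (1 / z + \<eta>)"
      using \<eta> by (simp add: G_def linear_add[OF bounded_linear.linear[OF blL]])
    moreover have "cmod \<eta> \<le> 2 * (\<epsilon>\<^sup>2 * K)"
      using Llow[of \<eta>] K[OF z] z \<eta> by (simp add: norm_mult norm_power)
        (smt (verit) mult_left_mono zero_le_power2)
    then have "cmod (1 / z + \<eta>) \<le> r"
      using norm_triangle_ineq[of "1 / z" \<eta>] z by (simp add: r_def norm_divide mult_ac)
    ultimately show ?thesis by auto
  qed
  have pole: "filterlim G at_infinity (at 0)"
  proof -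
    have "((\<lambda>z. b * z + z\<^sup>2 * k z) \<longlongrightarrow> b * 0 + 0\<^sup>2 * k 0) (at 0)"
      by (intro tendsto_intros isCont_tendsto_compose[where g = k])
        (use holomorphic_on_imp_continuous_on[OF k] in \<open>auto simp: continuous_on_eq_continuous_at\<close>)
    moreover have "filterlim (\<lambda>z. 1 / z) at_infinity (at (0::complex))"
    proof -
      have "(\<lambda>z::complex. 1 / z) = inverse" by (simp add: fun_eq_iff inverse_eq_divide)
      then show ?thesis by (simp only: filterlim_inverse_at_infinity)
    qed
    ultimately have "filterlim (\<lambda>z. 1 / z + (b * z + z\<^sup>2 * k z)) at_infinity (at 0)"
      by (intro tendsto_add_filterlim_at_infinity')
    then show ?thesis by (simp add: G_def[abs_def] add.assoc)
  qed
  have contL: "continuous_on (cball 0 r) L"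
    using blL by (rule linear_continuous_on)
  have cmpL: "compact (L ` cball 0 r)"
    by (rule compact_continuous_image[OF contL compact_cball])
  have convL: "convex (L ` cball 0 r)"
    by (rule convex_linear_image[OF bounded_linear.linear[OF blL] convex_cball])
  have sub: "\<Psi> ` R \<subseteq> V ` cball 0 r"
  proof clarify
    fix x assume "x \<in> R"
    then have x: "s0 < x $ 1" "x $ 1 < s1" by (auto simp: R_def mem_box_cart forall_2)
    have "ln \<epsilon> < x $ 1" "x $ 1 < ln \<rho>" using x by (auto simp: s0_def s1_def)
    then have "\<epsilon> < exp (x $ 1)" "exp (x $ 1) < \<rho>" using eps by (metis exp_less_cancel_iff exp_ln order.strict_trans)+
    then have "\<epsilon> \<le> cmod (exp (complex_of_vec x))" "cmod (exp (complex_of_vec x)) < 1"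
      using eps x s by simp_all
    then have "G (exp (complex_of_vec x)) \<in> L ` cball 0 r"
      using eps by (intro image_outside_circle_subset[OF holomorphic_on_imp_continuous_on[OF Ghol] Ginj pole eps(1) _ cmpL convL circ]) simp_all
    then obtain \<zeta> where \<zeta>: "cmod \<zeta> \<le> r" "G (exp (complex_of_vec x)) = L \<zeta>" by auto
    then have "\<Psi> x = V (vec_of_complex \<zeta>)" "vec_of_complex \<zeta> \<in> cball 0 r"
      by (simp_all add: \<Psi>_def V_def norm_vec_of_complex)
    then show "\<Psi> x \<in> V ` cball 0 r" by blast
  qed
  have linV: "linear V" using blV by (rule bounded_linear.linear)
  have lmV: "V ` cball 0 r \<in> lmeasurable"
    using measurable_linear_image[OF linV] by simp
  have "measure lebesgue (\<Psi> ` R) \<le> measure lebesgue (V ` cball 0 r)"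
    by (rule measure_mono_fmeasurable[OF sub _ lmV]) (use rect(1) in \<open>simp add: fmeasurableD\<close>)
  also have "\<dots> = \<bar>det (matrix V)\<bar> * measure lebesgue (cball (0::real^2) r)"
    by (rule measure_linear_image[OF linV]) simp
  also have "measure lebesgue (cball (0::real^2) r) = pi * r\<^sup>2"
    using r0 by (simp add: content_cball unit_ball_vol_2)
  also have "\<bar>det (matrix V)\<bar> * (pi * r\<^sup>2) \<le> 1 * (pi * r\<^sup>2)"
  proof (rule mult_right_mono)
    have "(cmod (b * of_real (\<epsilon>\<^sup>2)))\<^sup>2 \<le> 1" using c2 by (simp add: power_le_one)
    then show "\<bar>det (matrix V)\<bar> \<le> 1" unfolding detV by simp
  qed simp
  finally have up: "measure lebesgue (\<Psi> ` R) \<le> pi * r\<^sup>2" by simp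
  have "pi * (exp (- 2 * s0) - exp (- 2 * s1)) + pi * (cmod b)\<^sup>2 * (exp (2 * s1) - exp (2 * s0)) \<le> pi * r\<^sup>2"
    using area_logarithmic_rectangle_ge[OF s m Jeq rect(3)] up rect(2) by simp
  moreover have "exp (- 2 * s0) = 1 / \<epsilon>\<^sup>2" "exp (2 * s0) = \<epsilon>\<^sup>2" "exp (- 2 * s1) = 1 / \<rho>\<^sup>2" "exp (2 * s1) = \<rho>\<^sup>2"
    using eps by (simp_all add: s0_def s1_def exp_minus exp_double inverse_eq_divide)
  ultimately have "pi * ((1 / \<epsilon>\<^sup>2 - 1 / \<rho>\<^sup>2) + (cmod b)\<^sup>2 * (\<rho>\<^sup>2 - \<epsilon>\<^sup>2)) \<le> pi * r\<^sup>2"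
    by (simp add: algebra_simps)
  then have "(1 / \<epsilon>\<^sup>2 - 1 / \<rho>\<^sup>2) + (cmod b)\<^sup>2 * (\<rho>\<^sup>2 - \<epsilon>\<^sup>2) \<le> r\<^sup>2"
    by (simp add: mult_le_cancel_left_pos)
  \<comment> \<open>The leading term \<open>1 / \<epsilon>^2\<close> occurs on both sides and
    cancels; besides \<open>1 / \<rho>^2\<close> only terms vanishing with \<open>\<epsilon>\<close>
    remain.\<close>
  also have "r\<^sup>2 = 1 / \<epsilon>\<^sup>2 + 4 * K * \<epsilon> + 4 * K\<^sup>2 * \<epsilon> ^ 4"
    using eps by (simp add: r_def power2_eq_square field_simps power4_eq_xxxx)
  finally show ?thesis by simp
qed

text \<open>For fixed \<open>\<rho>\<close> the error terms of \<open>area_inequality\<close> vanish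
  as \<open>\<epsilon>\<close> tends to 0, which leaves
  \<open>|b|^2 * \<rho>^2 \<le> 1 / \<rho>^2\<close>; then \<open>\<rho>\<close> tends to 1.\<close>

theorem area_theorem:
  fixes b :: complex
  assumes k: "k holomorphic_on ball 0 1"
    and inj: "inj_on (\<lambda>z. 1 / z + b * z + z\<^sup>2 * k z) (ball 0 1 - {0})"
  shows "cmod b \<le> 1"
proof -
  \<comment> \<open>The bound is taken on a fixed disc, so that \<open>K\<close> does not change
    while \<open>\<epsilon>\<close> tends to 0.\<close>
  have "bounded (k ` cball 0 (1/2))"
    by (intro compact_imp_bounded compact_continuous_image holomorphic_on_imp_continuous_on holomorphic_on_subset[OF k]) auto
  then obtain K where K: "\<forall>z\<in>cball 0 (1/2). cmod (k z) \<le> K"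
    by (auto simp: bounded_iff)
  have le: "(cmod b)\<^sup>2 * \<rho>\<^sup>2 \<le> 1 / \<rho>\<^sup>2" if \<rho>: "0 < \<rho>" "\<rho> < 1" for \<rho>
  proof (rule tendsto_le[OF trivial_limit_at_right_real])
    show "((\<lambda>\<epsilon>. 1 / \<rho>\<^sup>2 + 4 * K * \<epsilon> + 4 * K\<^sup>2 * \<epsilon> ^ 4) \<longlongrightarrow> 1 / \<rho>\<^sup>2) (at_right 0)"
      by (rule tendsto_eq_intros refl | simp)+
    show "((\<lambda>\<epsilon>. (cmod b)\<^sup>2 * (\<rho>\<^sup>2 - \<epsilon>\<^sup>2)) \<longlongrightarrow> (cmod b)\<^sup>2 * \<rho>\<^sup>2) (at_right 0)"
      by (rule tendsto_eq_intros refl | simp)+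
    have "((\<lambda>\<epsilon>. cmod b * \<epsilon>\<^sup>2) \<longlongrightarrow> 0) (at_right 0)"
      by (rule tendsto_eq_intros refl | simp)+
    then have "\<forall>\<^sub>F \<epsilon> in at_right 0. cmod b * \<epsilon>\<^sup>2 < 1 / 2"
      by (rule order_tendstoD) simp
    moreover have "\<forall>\<^sub>F \<epsilon> in at_right 0. \<epsilon> \<in> {0<..<min \<rho> (1/2)}"
      using \<rho> by (intro eventually_at_right_real) simp
    ultimately show "\<forall>\<^sub>F \<epsilon> in at_right 0. (cmod b)\<^sup>2 * (\<rho>\<^sup>2 - \<epsilon>\<^sup>2) \<le> 1 / \<rho>\<^sup>2 + 4 * K * \<epsilon> + 4 * K\<^sup>2 * \<epsilon> ^ 4"
      by eventually_elim (rule area_inequality[OF k _ inj]; use K \<rho> in auto)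
  qed
  have "(cmod b)\<^sup>2 * 1\<^sup>2 \<le> 1 / 1\<^sup>2"
  proof (rule tendsto_le[OF trivial_limit_at_left_real])
    show "((\<lambda>\<rho>. 1 / \<rho>\<^sup>2) \<longlongrightarrow> 1 / 1\<^sup>2) (at_left (1::real))" by (intro tendsto_intros) simp
    show "((\<lambda>\<rho>. (cmod b)\<^sup>2 * \<rho>\<^sup>2) \<longlongrightarrow> (cmod b)\<^sup>2 * 1\<^sup>2) (at_left (1::real))" by (intro tendsto_intros)
    have "\<forall>\<^sub>F \<rho> in at_left 1. \<rho> \<in> {0<..<1::real}" by (rule eventually_at_left_real) simp
    then show "\<forall>\<^sub>F \<rho> in at_left 1. (cmod b)\<^sup>2 * \<rho>\<^sup>2 \<le> 1 / \<rho>\<^sup>2"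
      by eventually_elim (use le in auto)
  qed
  then show ?thesis using power2_le_imp_le[of "cmod b" 1] by simp
qed

section \<open>Bieberbach's inequality and distortion in the half-plane\<close>

text \<open>Two successive difference quotients at 0, each with its removable singularity filled in.
  The remainder is holomorphic on the whole disc, as the area theorem demands.\<close>

lemma holomorphic_second_order_expansion:
  assumes v: "v holomorphic_on ball 0 1"
  obtains w where "w holomorphic_on ball 0 1" "\<And>u. u \<in> ball 0 1 \<Longrightarrow> v u = v 0 + deriv v 0 * u + u\<^sup>2 * w u"
proof -
  have 0: "(0::complex) \<in> interior (ball 0 1)" by (simp add: interior_open)
  define v1 where "v1 z = (if z = 0 then deriv v 0 else (v z - v 0) / (z - 0))" for z
  have v1: "v1 holomorphic_on ball 0 1" unfolding v1_def by (rule pole_lemma[OF v 0])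
  define w where "w z = (if z = 0 then deriv v1 0 else (v1 z - v1 0) / (z - 0))" for z
  have w: "w holomorphic_on ball 0 1" unfolding w_def by (rule pole_lemma[OF v1 0])
  have "v u = v 0 + deriv v 0 * u + u\<^sup>2 * w u" for u
    by (simp add: w_def v1_def power2_eq_square field_simps)
  then show ?thesis using that w by blast
qed

text \<open>The odd square root transform turns the second coefficient into the coefficient bounded
  by the area theorem.\<close>

theorem Bieberbach_second_coefficient:
  assumes f: "f holomorphic_on ball 0 1" and inj: "inj_on f (ball 0 1)"
  shows "cmod (deriv (deriv f) 0) \<le> 4 * cmod (deriv f 0)"
proof -
  define c where "c = deriv f 0"
  have c0: "c \<noteq> 0" unfolding c_def
    by (rule holomorphic_injective_imp_regular[OF f open_ball inj]) simp
  define p where "p z = (if z = 0 then deriv f 0 else (f z - f 0) / (z - 0))" for z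
  have p: "p holomorphic_on ball 0 1"
    unfolding p_def by (rule pole_lemma[OF f]) (simp add: interior_open)
  have fp: "f z = f 0 + z * p z" for z by (simp add: p_def)
  have p0: "p 0 = c" by (simp add: p_def c_def)
  have pnz: "p z \<noteq> 0" if "z \<in> ball 0 1" for z
    using that c0 p0 fp[of z] inj_onD[OF inj, of z 0] by fastforce
  have derp: "(p has_field_derivative deriv p z) (at z)" if "z \<in> ball 0 1" for z
    using holomorphic_derivI[OF p open_ball that] .
  have f2: "deriv (deriv f) 0 = 2 * deriv p 0"
  proof -
    have 1: "deriv f z = p z + z * deriv p z" if "z \<in> ball 0 1" for z
    proof (rule DERIV_imp_deriv)
      have "((\<lambda>z. f 0 + z * p z) has_field_derivative p z + z * deriv p z) (at z)"
        using derp[OF that] by (auto intro!: derivative_eq_intros)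
      then show "(f has_field_derivative p z + z * deriv p z) (at z)"
        by (rule has_field_derivative_transform_within_open[OF _ open_UNIV]) (simp_all only: UNIV_I fp[symmetric])
    qed
    have "(deriv p has_field_derivative deriv (deriv p) 0) (at 0)"
      by (rule holomorphic_derivI[OF holomorphic_deriv[OF p open_ball] open_ball]) simp
    then have "((\<lambda>z. p z + z * deriv p z) has_field_derivative 2 * deriv p 0) (at 0)"
      using derp[of 0] by (auto intro!: derivative_eq_intros)
    then have "(deriv f has_field_derivative 2 * deriv p 0) (at 0)"
      by (rule has_field_derivative_transform_within_open[OF _ open_ball[of 0 1]]) (use 1 in auto)
    then show ?thesis by (rule DERIV_imp_deriv)
  qed
  obtain v0 where v0: "v0 holomorphic_on ball 0 1" "\<And>z. z \<in> ball 0 1 \<Longrightarrow> c / p z = (v0 z)\<^sup>2"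
    by (rule contractible_imp_holomorphic_sqrt[of "\<lambda>z. c / p z" "ball 0 1"])
      (use c0 pnz in \<open>auto intro!: holomorphic_intros p convex_imp_contractible\<close>)
  \<comment> \<open>\<open>v0 0\<close> is 1 or -1; as a factor it normalises the root to
    \<open>v 0 = 1\<close> without changing the square.\<close>
  define v where "v z = v0 0 * v0 z" for z
  have v00: "(v0 0)\<^sup>2 = 1" using v0(2)[of 0] p0 c0 by simp
  have v: "v holomorphic_on ball 0 1" unfolding v_def by (intro holomorphic_intros v0)
  have v2: "(v z)\<^sup>2 = c / p z" if "z \<in> ball 0 1" for z
    using v0(2)[OF that] v00 by (simp add: v_def power_mult_distrib)
  have v0': "v 0 = 1" using v00 by (simp add: v_def power2_eq_square)
  define b where "b = deriv v 0"
  have b: "2 * b = - deriv p 0 / c"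
  proof -
    have "((\<lambda>z. (v z)\<^sup>2) has_field_derivative 2 * v 0 * deriv v 0) (at 0)"
      using holomorphic_derivI[OF v open_ball, of 0] by (auto intro!: derivative_eq_intros)
    then have 1: "((\<lambda>z. c / p z) has_field_derivative 2 * v 0 * deriv v 0) (at 0)"
      by (rule has_field_derivative_transform_within_open[OF _ open_ball[of 0 1]]) (use v2 in auto)
    have "((\<lambda>z. c / p z) has_field_derivative - (c * deriv p 0) / (p 0)\<^sup>2) (at 0)"
      using derp[of 0] pnz[of 0] by (auto intro!: derivative_eq_intros simp: power2_eq_square)
    then have "2 * v 0 * deriv v 0 = - (c * deriv p 0) / (p 0)\<^sup>2"
      using 1 DERIV_unique by blast
    then show ?thesis using c0 by (simp add: v0' p0 b_def power2_eq_square)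
  qed
  obtain w where w: "w holomorphic_on ball 0 1" "\<And>u. u \<in> ball 0 1 \<Longrightarrow> v u = v 0 + deriv v 0 * u + u\<^sup>2 * w u"
    using holomorphic_second_order_expansion[OF v] by blast
  have sq: "z\<^sup>2 \<in> ball 0 1" if "z \<in> ball 0 1" for z :: complex
    using that by (simp add: norm_power power_less_one_iff)
  \<comment> \<open>On the punctured disc this is the reciprocal of an odd square root of
    \<open>(f (z^2) - f 0) / c\<close>. The expansion of \<open>v\<close> at \<open>z^2\<close>
    makes \<open>b = deriv v 0\<close> the coefficient of \<open>z\<close>, and there is no constant
    term.\<close>
  define G where "G z = 1 / z + b * z + z\<^sup>2 * (z * w (z\<^sup>2))" for z
  have G: "G z = v (z\<^sup>2) / z" if "z \<in> ball 0 1 - {0}" for z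
    using w(2)[OF sq, of z] that by (simp add: G_def v0' b_def power2_eq_square field_simps)
  have "cmod b \<le> 1"
  proof (rule area_theorem)
    show "(\<lambda>z. z * w (z\<^sup>2)) holomorphic_on ball 0 1"
      by (intro holomorphic_intros holomorphic_on_compose_gen[OF _ w(1), unfolded o_def]) (use sq in auto)
    show "inj_on (\<lambda>z. 1 / z + b * z + z\<^sup>2 * (z * w (z\<^sup>2))) (ball 0 1 - {0})"
      unfolding G_def[symmetric]
    proof (rule inj_onI)
      fix x y assume x: "x \<in> ball 0 1 - {0}" and y: "y \<in> ball 0 1 - {0}" and xy: "G x = G y"
      have G2: "(G z)\<^sup>2 = c / (f (z\<^sup>2) - f 0)" if "z \<in> ball 0 1 - {0}" for z
        using that v2[OF sq, of z] fp[of "z\<^sup>2"] by (simp add: G power_divide)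
      have nz: "f (z\<^sup>2) - f 0 \<noteq> 0" if "z \<in> ball 0 1 - {0}" for z
        using inj_onD[OF inj, of "z\<^sup>2" 0] sq[of z] that by auto
      have "c / (f (x\<^sup>2) - f 0) = c / (f (y\<^sup>2) - f 0)"
        by (metis G2[OF x] G2[OF y] xy)
      then have "f (x\<^sup>2) = f (y\<^sup>2)" using c0 nz[OF x] nz[OF y] by (simp add: field_simps)
      then have "x\<^sup>2 = y\<^sup>2" using inj_onD[OF inj] sq x y by blast
      then have "x = y \<or> x = - y" by (simp add: power2_eq_iff)
      \<comment> \<open>\<open>G\<close> is odd and has no zero, so it separates \<open>y\<close>
        from \<open>- y\<close>.\<close>
      moreover have False if "x = - y"
      proof -
        have "G x = - G y" using G[OF x] G[OF y] that by simp
        then have "G y = 0" using xy by simp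
        then show False using G2[OF y] nz[OF y] c0 by simp
      qed
      ultimately show "x = y" by blast
    qed
  qed
  moreover have "deriv (deriv f) 0 = - 4 * c * b"
    using b c0 f2 by (simp add: field_simps)
  ultimately show ?thesis
    using mult_left_le[of "cmod b" "cmod c"] by (simp add: norm_mult c_def)
qed

text \<open>The map is the Cayley transform \<open>(1 + z) / (1 - z)\<close>, stretched by
  \<open>Re \<zeta>\<close> and shifted vertically by \<open>Im \<zeta>\<close>, so that 0 goes to
  \<open>\<zeta>\<close>.\<close>

lemma halfplane_mobius_Re_pos:
  fixes \<zeta> :: complex
  assumes "0 < Re \<zeta>" "z \<in> ball 0 1"
  shows "0 < Re (\<zeta> + 2 * of_real (Re \<zeta>) * (z / (1 - z)))"
proof -
  have z: "1 - z \<noteq> 0" "cmod z < 1" using assms by auto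
  have "(X + \<i> * Y) + 2 * X * (z / (1 - z)) = \<i> * Y + X * ((1 + z) / (1 - z))" for X Y
    using z by (simp add: field_simps)
  from this[of "of_real (Re \<zeta>)" "of_real (Im \<zeta>)"]
  have "\<zeta> + 2 * of_real (Re \<zeta>) * (z / (1 - z)) = \<i> * of_real (Im \<zeta>) + of_real (Re \<zeta>) * ((1 + z) / (1 - z))"
    by (simp only: complex_eq[symmetric])
  moreover have "Re ((1 + z) / (1 - z)) = (1 - (cmod z)\<^sup>2) / (cmod (1 - z))\<^sup>2"
    unfolding Re_divide cmod_power2 by (simp add: power2_eq_square algebra_simps)
  moreover have pos: "(1 - (cmod z)\<^sup>2) / (cmod (1 - z))\<^sup>2 > 0"
    using z by (simp add: power_less_one_iff)
  ultimately have "Re (\<zeta> + 2 * of_real (Re \<zeta>) * (z / (1 - z))) = Re \<zeta> * ((1 - (cmod z)\<^sup>2) / (cmod (1 - z))\<^sup>2)"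
    by (simp del: times_divide_eq_right)
  then show ?thesis using assms(1) pos by (simp only: mult_pos_pos)
qed

text \<open>Bieberbach's inequality is applied to \<open>F\<close> after the Moebius map
  \<open>M\<close> with \<open>M 0 = \<zeta>\<close>. With \<open>x = Re \<zeta>\<close> one has
  \<open>M'(0) = 2 x\<close> and \<open>M''(0) = 4 x\<close>; the latter produces the summand
  1.\<close>

lemma univalent_halfplane_distortion:
  assumes F: "F holomorphic_on {z. 0 < Re z}" and inj: "inj_on F {z. 0 < Re z}" and \<zeta>: "0 < Re \<zeta>"
  shows "cmod (of_real (Re \<zeta>) * (deriv (deriv F) \<zeta> / deriv F \<zeta>) + 1) \<le> 2"
proof -
  define x where "x = complex_of_real (Re \<zeta>)"
  have x0: "x \<noteq> 0" using \<zeta> by (simp add: x_def)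
  define M where "M z = \<zeta> + 2 * x * (z / (1 - z))" for z
  have op: "open {z. 0 < Re z}" by (simp add: open_halfspace_Re_gt)
  have MH: "M z \<in> {z. 0 < Re z}" if "z \<in> ball 0 1" for z
    using halfplane_mobius_Re_pos[OF \<zeta> that] by (simp add: M_def x_def)
  have dM: "(M has_field_derivative 2 * x / (1 - z)\<^sup>2) (at z)" if "z \<in> ball 0 1" for z
  proof -
    have "1 - z \<noteq> 0" using that by auto
    then show ?thesis unfolding M_def
      by (auto intro!: derivative_eq_intros simp: power2_eq_square field_simps)
  qed
  have Mhol: "M holomorphic_on ball 0 1"
    using dM holomorphic_on_open[OF open_ball] by blast
  have Minj: "inj_on M (ball 0 1)"
  proof (rule inj_onI)
    fix u w assume u: "u \<in> ball 0 (1::real)" and w: "w \<in> ball 0 (1::real)" and uw: "M u = M w"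
    have "1 - u \<noteq> 0" "1 - w \<noteq> 0" using u w by auto
    moreover have "u / (1 - u) = w / (1 - w)" 
      using uw x0 unfolding M_def by (metis add_left_cancel mult_left_cancel mult_eq_0_iff zero_neq_numeral)
    ultimately show "u = w" by (simp add: field_simps)
  qed
  define f where "f z = F (M z)" for z
  have f: "f holomorphic_on ball 0 1"
  proof -
    have "M ` ball 0 1 \<subseteq> {z. 0 < Re z}" using MH by blast
    then show ?thesis unfolding f_def using holomorphic_on_compose_gen[OF Mhol F] by (simp add: o_def)
  qed
  have finj: "inj_on f (ball 0 1)"
  proof (rule inj_onI)
    fix u w assume uw: "u \<in> ball 0 1" "w \<in> ball 0 1" "f u = f w"
    then have "M u = M w" using inj_onD[OF inj, of "M u" "M w"] MH by (simp only: f_def)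
    then show "u = w" using inj_onD[OF Minj] uw by blast
  qed
  have dF: "(F has_field_derivative deriv F z) (at z)" if "z \<in> {z. 0 < Re z}" for z
    using holomorphic_derivI[OF F op that] .
  have ddF: "(deriv F has_field_derivative deriv (deriv F) z) (at z)" if "z \<in> {z. 0 < Re z}" for z
    using holomorphic_derivI[OF holomorphic_deriv[OF F op] op that] .
  have f1: "deriv f z = deriv F (M z) * (2 * x / (1 - z)\<^sup>2)" if "z \<in> ball 0 1" for z
    unfolding f_def by (rule DERIV_imp_deriv, rule DERIV_chain2[OF dF[OF MH[OF that]] dM[OF that]])
  have M0: "M 0 = \<zeta>" by (simp add: M_def)
  have "((\<lambda>z. deriv F (M z) * (2 * x / (1 - z)\<^sup>2)) has_field_derivative
      deriv (deriv F) \<zeta> * (2 * x) * (2 * x) + 4 * x * deriv F \<zeta>) (at 0)"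
  proof -
    have d1: "((\<lambda>z. deriv F (M z)) has_field_derivative deriv (deriv F) \<zeta> * (2 * x / (1 - 0)\<^sup>2)) (at 0)"
      by (rule DERIV_chain2[OF _ dM]) (use ddF \<zeta> M0 in auto)
    have d2: "((\<lambda>z. 2 * x / (1 - z)\<^sup>2) has_field_derivative 4 * x) (at 0)"
      by (auto intro!: derivative_eq_intros)
    show ?thesis
      using DERIV_mult[OF d1 d2] by (simp add: M0 mult_ac)
  qed
  then have "(deriv f has_field_derivative deriv (deriv F) \<zeta> * (2 * x) * (2 * x) + 4 * x * deriv F \<zeta>) (at 0)"
    by (rule has_field_derivative_transform_within_open[OF _ open_ball[of 0 1]]) (use f1 in auto)
  then have f2: "deriv (deriv f) 0 = 4 * x * (x * deriv (deriv F) \<zeta> + deriv F \<zeta>)"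
    by (subst DERIV_imp_deriv, assumption, simp add: algebra_simps)
  have "cmod (4 * x * (x * deriv (deriv F) \<zeta> + deriv F \<zeta>)) \<le> 4 * cmod (deriv F \<zeta> * (2 * x))"
    using Bieberbach_second_coefficient[OF f finj] f1[of 0] by (simp add: f2 M0)
  then have "cmod (x * deriv (deriv F) \<zeta> + deriv F \<zeta>) \<le> 2 * cmod (deriv F \<zeta>)"
    using x0 by (simp add: norm_mult)
  moreover have nz: "deriv F \<zeta> \<noteq> 0"
    by (rule holomorphic_injective_imp_regular[OF F op inj]) (use \<zeta> in auto)
  moreover have "x * (deriv (deriv F) \<zeta> / deriv F \<zeta>) + 1 = (x * deriv (deriv F) \<zeta> + deriv F \<zeta>) / deriv F \<zeta>"
    using nz by (simp add: field_simps)
  ultimately show ?thesis by (simp add: norm_divide divide_le_eq x_def)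
qed

text \<open>The two bounds of the previous lemma for \<open>F\<close> and \<open>1 / F\<close> are averaged with the weights
  \<open>1 / (1 + |F|\<^sup>2)\<close> and \<open>|F|\<^sup>2 / (1 + |F|\<^sup>2)\<close>. Geometrically, the map becomes holomorphic
  with value \<open>0\<close> at \<open>\<zeta>\<close> after a rotation of the sphere and omits two antipodal points.\<close>

lemma univalent_halfplane_spherical_distortion:
  assumes F: "F holomorphic_on {z. 0 < Re z}" and inj: "inj_on F {z. 0 < Re z}"
    and nz: "\<And>z. 0 < Re z \<Longrightarrow> F z \<noteq> 0" and \<zeta>: "0 < Re \<zeta>"
  shows "cmod (of_real (Re \<zeta>) * (deriv (deriv F) \<zeta> / deriv F \<zeta>
      - 2 * cnj (F \<zeta>) * deriv F \<zeta> / of_real (1 + (cmod (F \<zeta>))\<^sup>2)) + 1) \<le> 2"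
proof -
  define H where "H = {z. 0 < Re z}"
  have op: "open H" by (simp add: H_def open_halfspace_Re_gt)
  have \<zeta>H: "\<zeta> \<in> H" using \<zeta> by (simp add: H_def)
  note F = F[folded H_def] and inj = inj[folded H_def]
  define K where "K z = 1 / F z" for z
  have FH: "F z \<noteq> 0" if "z \<in> H" for z using nz that by (simp add: H_def)
  have K: "K holomorphic_on H" unfolding K_def by (intro holomorphic_intros F FH)
  have Kinj: "inj_on K H"
    using inj FH unfolding K_def inj_on_def by simp
  have d0: "deriv F \<zeta> \<noteq> 0" by (rule holomorphic_injective_imp_regular[OF F op inj \<zeta>H])
  have dF: "(F has_field_derivative deriv F z) (at z)" if "z \<in> H" for z
    using holomorphic_derivI[OF F op that] .
  have ddF: "(deriv F has_field_derivative deriv (deriv F) z) (at z)" if "z \<in> H" for z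
    using holomorphic_derivI[OF holomorphic_deriv[OF F op] op that] .
  have K1: "deriv K z = - deriv F z / (F z)\<^sup>2" if "z \<in> H" for z
    unfolding K_def using dF[OF that] FH[OF that]
    by (intro DERIV_imp_deriv) (auto intro!: derivative_eq_intros simp: power2_eq_square)
  define K2 where "K2 = - deriv (deriv F) \<zeta> / (F \<zeta>)\<^sup>2 + 2 * (deriv F \<zeta>)\<^sup>2 / (F \<zeta>) ^ 3"
  have "((\<lambda>z. - deriv F z / (F z)\<^sup>2) has_field_derivative K2) (at \<zeta>)"
    unfolding K2_def using dF[OF \<zeta>H] ddF[OF \<zeta>H] FH[OF \<zeta>H]
    by (auto intro!: derivative_eq_intros simp: power2_eq_square power3_eq_cube field_simps)
  then have "(deriv K has_field_derivative K2) (at \<zeta>)"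
    by (rule has_field_derivative_transform_within_open[OF _ op \<zeta>H]) (use K1 in auto)
  then have "deriv (deriv K) \<zeta> = K2" by (rule DERIV_imp_deriv)
  then have ratio: "deriv (deriv K) \<zeta> / deriv K \<zeta> = deriv (deriv F) \<zeta> / deriv F \<zeta> - 2 * deriv F \<zeta> / F \<zeta>"
    using d0 FH[OF \<zeta>H] by (simp add: K1[OF \<zeta>H] K2_def field_simps power2_eq_square power3_eq_cube)
  define x where "x = complex_of_real (Re \<zeta>)"
  define A where "A = deriv (deriv F) \<zeta> / deriv F \<zeta>"
  define B where "B = deriv F \<zeta> / F \<zeta>"
  define n where "n = (cmod (F \<zeta>))\<^sup>2"
  have n: "n \<ge> 0" "complex_of_real n = F \<zeta> * cnj (F \<zeta>)"
    by (simp_all add: n_def complex_norm_square flip: of_real_power)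
  have A2: "cmod (x * A + 1) \<le> 2"
    using univalent_halfplane_distortion[OF F[unfolded H_def] inj[unfolded H_def] \<zeta>] by (simp add: x_def A_def)
  have B2: "cmod (x * (A - 2 * B) + 1) \<le> 2"
    using univalent_halfplane_distortion[OF K[unfolded H_def] Kinj[unfolded H_def] \<zeta>]
    by (simp add: x_def A_def B_def ratio)
  have pos: "complex_of_real (1 + n) \<noteq> 0" using n(1) by (metis add_nonneg_eq_0_iff of_real_eq_0_iff zero_le_one zero_neq_one)
  have n1: "cmod (complex_of_real (1 + n)) = 1 + n" unfolding norm_of_real using n(1) by simp
  \<comment> \<open>In terms of \<open>B = F' / F\<close> the quantity to be bounded is the average
    of \<open>x A + 1\<close> and \<open>x (A - 2 B) + 1\<close> with weights proportional to 1 and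
    \<open>n\<close>; both lie in the disc of radius 2 about 0.\<close>
  have "cnj (F \<zeta>) * deriv F \<zeta> = of_real n * B"
    using FH[OF \<zeta>H] by (simp add: n B_def)
  then have "x * (A - 2 * cnj (F \<zeta>) * deriv F \<zeta> / of_real (1 + n)) + 1 = x * (A - 2 * (of_real n * B) / of_real (1 + n)) + 1"
    by (simp add: mult.assoc)
  also have "\<dots> = ((x * A + 1) + of_real n * (x * (A - 2 * B) + 1)) / of_real (1 + n)"
    using pos by (simp add: field_simps)
  finally have "cmod (x * (A - 2 * cnj (F \<zeta>) * deriv F \<zeta> / of_real (1 + n)) + 1)
      = cmod ((x * A + 1) + of_real n * (x * (A - 2 * B) + 1)) / (1 + n)"
    by (simp only: norm_divide n1)
  also have "\<dots> \<le> (2 + n * 2) / (1 + n)"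
  proof (rule divide_right_mono)
    have "cmod ((x * A + 1) + of_real n * (x * (A - 2 * B) + 1)) \<le> cmod (x * A + 1) + n * cmod (x * (A - 2 * B) + 1)"
      using norm_triangle_ineq[of "x * A + 1" "of_real n * (x * (A - 2 * B) + 1)"] n(1) by (simp add: norm_mult)
    also have "\<dots> \<le> 2 + n * 2" using A2 B2 n(1) by (intro add_mono mult_left_mono)
    finally show "cmod ((x * A + 1) + of_real n * (x * (A - 2 * B) + 1)) \<le> 2 + n * 2" .
  qed (use n in simp)
  also have "\<dots> = 2" using n(1) by (simp add: field_simps)
  finally show ?thesis by (simp only: x_def A_def n_def)
qed

text \<open>The domain keeps its Euclidean metric because \<open>\<zeta>\<close> is only an
  auxiliary coordinate; hence the factor \<open>1 + |z|^2\<close> of \<open>sph_deriv\<close> is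
  absent. It returns with the derivative of \<open>log_param\<close>.\<close>

definition sph_density :: "(complex \<Rightarrow> complex) \<Rightarrow> complex \<Rightarrow> real" where
  "sph_density F \<zeta> = cmod (deriv F \<zeta>) / (1 + (cmod (F \<zeta>))\<^sup>2)"

section \<open>Integration of the logarithmic gradient of the spherical density\<close>

lemma has_real_derivative_norm_square_along_line:
  assumes g: "(g has_field_derivative g') (at (\<zeta> + of_real t * e))"
  shows "((\<lambda>t. (cmod (g (\<zeta> + of_real t * e)))\<^sup>2) has_real_derivative 2 * Re (cnj (g (\<zeta> + of_real t * e)) * (e * g'))) (at t)"
proof -
  define p where "p t = g (\<zeta> + of_real t * e)" for t
  have "((\<lambda>t. \<zeta> + of_real t * e) has_vector_derivative e) (at t)"
    by (auto intro!: derivative_eq_intros simp: has_vector_derivative_def fun_eq_iff scaleR_conv_of_real)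
  then have "(g \<circ> (\<lambda>t. \<zeta> + of_real t * e) has_vector_derivative e * g') (at t)"
    using field_vector_diff_chain_within[of "\<lambda>t. \<zeta> + of_real t * e" e t UNIV g g'] g
    by (auto intro: has_field_derivative_at_within)
  then have p: "(p has_vector_derivative e * g') (at t)" by (simp add: p_def[abs_def] o_def)
  have "((\<lambda>t. Re (p t)) has_real_derivative Re (e * g')) (at t)"
    using bounded_linear.has_vector_derivative[OF bounded_linear_Re p] by (simp add: has_real_derivative_iff_has_vector_derivative)
  moreover have "((\<lambda>t. Im (p t)) has_real_derivative Im (e * g')) (at t)"
    using bounded_linear.has_vector_derivative[OF bounded_linear_Im p] by (simp add: has_real_derivative_iff_has_vector_derivative)
  moreover have "((\<lambda>t. (a t)\<^sup>2 + (b t)\<^sup>2) has_real_derivative 2 * a t * a' + 2 * b t * b') (at t)"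
    if "(a has_real_derivative a') (at t)" "(b has_real_derivative b') (at t)" for a b :: "real \<Rightarrow> real" and a' b'
    using that by (auto intro!: derivative_eq_intros)
  ultimately have "((\<lambda>t. (Re (p t))\<^sup>2 + (Im (p t))\<^sup>2) has_real_derivative 2 * Re (p t) * Re (e * g') + 2 * Im (p t) * Im (e * g')) (at t)"
    by blast
  then show ?thesis by (simp add: cmod_power2 p_def algebra_simps)
qed

text \<open>The logarithm is \<open>ln (|F'|^2) / 2 - ln (1 + |F|^2)\<close>, built from squared
  moduli, which are differentiable along the line. The bracket is the gradient \<open>Q\<close>;
  \<open>e = 1\<close> and \<open>e = \<i>\<close> give the horizontal and the vertical
  derivative.\<close>

lemma has_real_derivative_ln_sph_density_along_line:
  assumes F: "F holomorphic_on S" "open S" "\<zeta> + of_real t * e \<in> S" and nz: "deriv F (\<zeta> + of_real t * e) \<noteq> 0"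
  defines "z \<equiv> \<zeta> + of_real t * e"
  shows "((\<lambda>t. ln (sph_density F (\<zeta> + of_real t * e))) has_real_derivative
     Re (e * (deriv (deriv F) z / deriv F z - 2 * cnj (F z) * deriv F z / of_real (1 + (cmod (F z))\<^sup>2)))) (at t)"
proof -
  have 1: "((\<lambda>t. (cmod (F (\<zeta> + of_real t * e)))\<^sup>2) has_real_derivative 2 * Re (cnj (F z) * (e * deriv F z))) (at t)"
    unfolding z_def by (rule has_real_derivative_norm_square_along_line[OF holomorphic_derivI[OF F]])
  have 2: "((\<lambda>t. (cmod (deriv F (\<zeta> + of_real t * e)))\<^sup>2) has_real_derivative 2 * Re (cnj (deriv F z) * (e * deriv (deriv F) z))) (at t)"
    unfolding z_def by (rule has_real_derivative_norm_square_along_line[OF holomorphic_derivI[OF holomorphic_deriv[OF F(1,2)] F(2,3)]])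
  have pos: "0 < 1 + (cmod (F w))\<^sup>2" for w by (simp add: add_pos_nonneg)
  have pos2: "0 < (cmod (deriv F z))\<^sup>2" using nz by (simp add: z_def)
  have "((\<lambda>t. ln ((cmod (deriv F (\<zeta> + of_real t * e)))\<^sup>2) / 2 - ln (1 + (cmod (F (\<zeta> + of_real t * e)))\<^sup>2)) has_real_derivative
      2 * Re (cnj (deriv F z) * (e * deriv (deriv F) z)) / (cmod (deriv F z))\<^sup>2 / 2
       - (2 * Re (cnj (F z) * (e * deriv F z))) / (1 + (cmod (F z))\<^sup>2)) (at t)"
  proof -
    have "((\<lambda>t. ln (A t) / 2 - ln (1 + B t)) has_real_derivative A' / A t / 2 - B' / (1 + B t)) (at t)"
      if "(A has_real_derivative A') (at t)" "(B has_real_derivative B') (at t)" "0 < A t" "0 < 1 + B t"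
      for A B :: "real \<Rightarrow> real" and A' B'
      using that by (auto intro!: derivative_eq_intros)
    from this[OF 2 1] show ?thesis using pos[of z] pos2 by (simp only: z_def[symmetric])
  qed
  note D = this
  have lneq: "ln ((cmod (deriv F w))\<^sup>2) / 2 - ln (1 + (cmod (F w))\<^sup>2) = ln (sph_density F w)"
    if "deriv F w \<noteq> 0" for w
    using that pos[of w] by (simp add: sph_density_def ln_div ln_realpow)
  \<comment> \<open>\<open>lneq\<close> asks for a nonzero derivative, so this is secured near
    \<open>t\<close> before the two functions are exchanged.\<close>
  have ne: "\<forall>\<^sub>F s in nhds t. deriv F (\<zeta> + of_real s * e) \<noteq> 0"
  proof -
    have "isCont (deriv F) (\<zeta> + of_real t * e)"
      using holomorphic_on_imp_continuous_on[OF holomorphic_deriv[OF F(1,2)]] F(2,3) by (simp add: continuous_on_eq_continuous_at)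
    moreover have "isCont (\<lambda>s. \<zeta> + of_real s * e) t" by (intro continuous_intros)
    ultimately have "isCont (\<lambda>s. deriv F (\<zeta> + of_real s * e)) t"
      using isCont_o2[of t "\<lambda>s. \<zeta> + of_real s * e" "deriv F"] by blast
    then have "((\<lambda>s. deriv F (\<zeta> + of_real s * e)) \<longlongrightarrow> deriv F (\<zeta> + of_real t * e)) (nhds t)"
      by (simp add: isCont_def tendsto_nhds_iff)
    then show ?thesis using nz by (rule tendsto_imp_eventually_ne)
  qed
  have "\<forall>\<^sub>F s in nhds t. ln ((cmod (deriv F (\<zeta> + of_real s * e)))\<^sup>2) / 2 - ln (1 + (cmod (F (\<zeta> + of_real s * e)))\<^sup>2) = ln (sph_density F (\<zeta> + of_real s * e))"
    using ne by (rule eventually_mono) (rule lneq)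
  from DERIV_cong_ev[OF refl this refl, THEN iffD1, OF D] have "((\<lambda>t. ln (sph_density F (\<zeta> + of_real t * e))) has_real_derivative
      2 * Re (cnj (deriv F z) * (e * deriv (deriv F) z)) / (cmod (deriv F z))\<^sup>2 / 2
       - (2 * Re (cnj (F z) * (e * deriv F z))) / (1 + (cmod (F z))\<^sup>2)) (at t)"
    .
  moreover have "2 * Re (cnj (deriv F z) * (e * deriv (deriv F) z)) / (cmod (deriv F z))\<^sup>2 / 2 = Re (e * (deriv (deriv F) z / deriv F z))"
  proof -
    have d: "deriv F z \<noteq> 0" using nz by (simp add: z_def)
    have "e * (deriv (deriv F) z / deriv F z) = cnj (deriv F z) * (e * deriv (deriv F) z) / of_real ((cmod (deriv F z))\<^sup>2)"
      using d by (simp add: complex_norm_square del: of_real_power)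
    then show ?thesis by (simp only: Re_divide_of_real) (simp del: times_complex.sel)
  qed
  moreover have "(2 * Re (cnj (F z) * (e * deriv F z))) / (1 + (cmod (F z))\<^sup>2) = Re (e * (2 * cnj (F z) * deriv F z / of_real (1 + (cmod (F z))\<^sup>2)))"
  proof -
    have "e * (2 * cnj (F z) * deriv F z / of_real (1 + (cmod (F z))\<^sup>2)) = of_real 2 * (cnj (F z) * (e * deriv F z)) / of_real (1 + (cmod (F z))\<^sup>2)"
      by (simp add: mult_ac)
    then show ?thesis by (simp only: Re_divide_of_real) simp
  qed
  ultimately show ?thesis by (simp only: right_diff_distrib minus_complex.sel)
qed

text \<open>The path from \<open>\<zeta>2\<close> to \<open>\<zeta>1\<close> has its corner at
  height \<open>Im \<zeta>2\<close> and real part \<open>Re \<zeta>1\<close>. On the vertical part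
  \<open>|Q| \<le> 3 / Re \<zeta>1 \<le> 3 / \<delta>\<close>, and its length is at most
  \<open>2 * pi\<close>: this is the origin of \<open>6 * pi / \<delta>\<close>.\<close>

theorem sph_density_univalent_halfplane:
  assumes F: "F holomorphic_on {z. 0 < Re z}" and inj: "inj_on F {z. 0 < Re z}"
    and nz: "\<And>z. 0 < Re z \<Longrightarrow> F z \<noteq> 0"
    and \<delta>: "0 < \<delta>" "\<delta> \<le> Re \<zeta>2" "Re \<zeta>2 \<le> Re \<zeta>1" and Im: "\<bar>Im \<zeta>1 - Im \<zeta>2\<bar> \<le> 2 * pi"
  shows "exp (- (6 * pi / \<delta>)) * (Re \<zeta>1 / Re \<zeta>2) powi (-3) \<le> sph_density F \<zeta>1 / sph_density F \<zeta>2"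
    and "sph_density F \<zeta>1 / sph_density F \<zeta>2 \<le> exp (6 * pi / \<delta>) * (Re \<zeta>1 / Re \<zeta>2)"
proof -
  have op: "open {z. 0 < Re z}" by (simp add: open_halfspace_Re_gt)
  define Q where "Q z = deriv (deriv F) z / deriv F z - 2 * cnj (F z) * deriv F z / of_real (1 + (cmod (F z))\<^sup>2)" for z
  define u where "u z = ln (sph_density F z)" for z
  have d0: "deriv F z \<noteq> 0" if "0 < Re z" for z
    by (rule holomorphic_injective_imp_regular[OF F op inj]) (use that in simp)
  have der: "((\<lambda>t. u (\<zeta> + of_real t * e)) has_real_derivative Re (e * Q (\<zeta> + of_real t * e))) (at t)"
    if "0 < Re (\<zeta> + of_real t * e)" for \<zeta> t e
    unfolding u_def Q_def
    by (rule has_real_derivative_ln_sph_density_along_line[OF F op]) (use that d0 in auto)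
  have Q: "cmod (of_real (Re z) * Q z + 1) \<le> 2" if "0 < Re z" for z
    unfolding Q_def by (rule univalent_halfplane_spherical_distortion[OF F inj nz that])
  have Re_Q: "Re (Q z) \<le> 1 / Re z" "- 3 / Re z \<le> Re (Q z)" if z: "0 < Re z" for z
  proof -
    have "\<bar>Re z * Re (Q z) + 1\<bar> \<le> 2"
      using abs_Re_le_cmod[of "of_real (Re z) * Q z + 1"] Q[OF z] by simp
    then have "Re z * Re (Q z) \<le> 1" "- 3 \<le> Re z * Re (Q z)" by linarith+
    then show "Re (Q z) \<le> 1 / Re z" "- 3 / Re z \<le> Re (Q z)"
      using z by (simp_all add: field_simps)
  qed
  have norm_Q: "cmod (Q z) \<le> 3 / Re z" if z: "0 < Re z" for z
  proof -
    have "cmod (of_real (Re z) * Q z) \<le> 3"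
      using norm_triangle_ineq4[of "of_real (Re z) * Q z + 1" 1] Q[OF z] by simp
    then show ?thesis using z by (simp add: norm_mult field_simps)
  qed
  define x1 x2 y1 y2 where "x1 = Re \<zeta>1" and "x2 = Re \<zeta>2" and "y1 = Im \<zeta>1" and "y2 = Im \<zeta>2"
  have x: "0 < x2" "x2 \<le> x1" "0 < x1" "\<delta> \<le> x2" using \<delta> by (simp_all add: x1_def x2_def)
  define P where "P t = \<i> * of_real y2 + of_real t * 1" for t
  have ReP: "Re (P t) = t" for t by (simp add: P_def)
  have derP: "((\<lambda>t. u (P t)) has_real_derivative Re (Q (P t))) (at t)" if "0 < t" for t
    using der[of "\<i> * of_real y2" t 1] that by (simp add: P_def)
  \<comment> \<open>The bounds for \<open>Re Q\<close> are used as monotonicity of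
    \<open>u - ln x\<close> here and of \<open>u + 3 ln x\<close> in \<open>horiz_low\<close>, in
    place of an integral.\<close>
  have horiz_up: "u (P x1) - ln x1 \<le> u (P x2) - ln x2"
  proof (rule DERIV_nonpos_imp_nonincreasing[OF x(2)])
    fix t assume t: "x2 \<le> t" "t \<le> x1"
    then have "0 < t" using x by simp
    then have "((\<lambda>t. u (P t) - ln t) has_real_derivative Re (Q (P t)) - 1 / t) (at t)"
      by (auto intro!: derivative_eq_intros derP)
    moreover have "Re (Q (P t)) - 1 / t \<le> 0" using Re_Q(1)[of "P t"] \<open>0 < t\<close> by (simp add: ReP)
    ultimately show "\<exists>y. ((\<lambda>t. u (P t) - ln t) has_real_derivative y) (at t) \<and> y \<le> 0" by blast
  qed
  have horiz_low: "u (P x2) + 3 * ln x2 \<le> u (P x1) + 3 * ln x1"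
  proof (rule DERIV_nonneg_imp_nondecreasing[OF x(2)])
    fix t assume t: "x2 \<le> t" "t \<le> x1"
    then have "0 < t" using x by simp
    then have "((\<lambda>t. u (P t) + 3 * ln t) has_real_derivative Re (Q (P t)) + 3 / t) (at t)"
      by (auto intro!: derivative_eq_intros derP)
    moreover have "Re (Q (P t)) + 3 / t \<ge> 0" using Re_Q(2)[of "P t"] \<open>0 < t\<close> by (simp add: ReP)
    ultimately show "\<exists>y. ((\<lambda>t. u (P t) + 3 * ln t) has_real_derivative y) (at t) \<and> 0 \<le> y" by blast
  qed
  have vert: "\<bar>u \<zeta>1 - u (P x1)\<bar> \<le> 6 * pi / \<delta>"
  proof -
    define V where "V t = of_real x1 + of_real t * \<i>" for t
    have ReV: "Re (V t) = x1" for t by (simp add: V_def)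
    have "norm (u (V y1) - u (V y2)) \<le> 3 / x1 * norm (y1 - y2)"
    proof (rule field_differentiable_bound[OF convex_UNIV])
      fix t
      show "((\<lambda>t. u (V t)) has_field_derivative Re (\<i> * Q (V t))) (at t within UNIV)"
        using der[of "of_real x1" t \<i>] x by (simp add: V_def)
      have "\<bar>Re (\<i> * Q (V t))\<bar> \<le> cmod (\<i> * Q (V t))" by (rule abs_Re_le_cmod)
      also have "\<dots> \<le> 3 / x1" using norm_Q[of "V t"] x by (simp add: ReV norm_mult)
      finally show "norm (Re (\<i> * Q (V t))) \<le> 3 / x1" by simp
    qed auto
    also have "\<dots> \<le> 3 / \<delta> * (2 * pi)"
      using x \<delta> Im by (intro mult_mono divide_left_mono) (auto simp: y1_def y2_def)
    finally have "\<bar>u (V y1) - u (V y2)\<bar> \<le> 6 * pi / \<delta>" by simp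
    moreover have "V y1 = \<zeta>1" "V y2 = P x1"
      by (simp_all add: V_def P_def x1_def y1_def complex_eq_iff)
    ultimately show ?thesis by simp
  qed
  have P2: "P x2 = \<zeta>2" by (simp add: P_def x2_def y2_def complex_eq_iff)
  have pos: "0 < sph_density F z" if "0 < Re z" for z
    using d0[OF that] by (simp add: sph_density_def add_pos_nonneg)
  have ratio: "sph_density F \<zeta>1 / sph_density F \<zeta>2 = exp (u \<zeta>1 - u \<zeta>2)"
    using pos[of \<zeta>1] pos[of \<zeta>2] x by (simp add: u_def exp_diff x1_def x2_def)
  have up: "u \<zeta>1 - u \<zeta>2 \<le> 6 * pi / \<delta> + (ln x1 - ln x2)"
    using vert horiz_up by (simp add: P2)
  have low: "- (6 * pi / \<delta>) - 3 * (ln x1 - ln x2) \<le> u \<zeta>1 - u \<zeta>2"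
    using vert horiz_low by (simp add: P2)
  have e: "exp (ln x1 - ln x2) = x1 / x2" using x by (simp add: exp_diff)
  show "sph_density F \<zeta>1 / sph_density F \<zeta>2 \<le> exp (6 * pi / \<delta>) * (Re \<zeta>1 / Re \<zeta>2)"
    unfolding ratio x1_def[symmetric] x2_def[symmetric] e[symmetric] exp_add[symmetric] using up by simp
  have "(x1 / x2) powi (-3) = exp (- 3 * (ln x1 - ln x2))"
    unfolding e[symmetric] exp_power_int by simp
  then show "exp (- (6 * pi / \<delta>)) * (Re \<zeta>1 / Re \<zeta>2) powi (-3) \<le> sph_density F \<zeta>1 / sph_density F \<zeta>2"
    unfolding ratio x1_def[symmetric] x2_def[symmetric] using low by (simp flip: exp_add)
qed

section \<open>Rotations of the sphere\<close>

text \<open>At its pole, the antipode of \<open>a\<close>, the rotation \<open>sph_rot a\<close> has the junk value \<open>0\<close>, which is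
  the proper value at \<open>a\<close>.\<close>

fun sph_rot :: "csphere \<Rightarrow> complex \<Rightarrow> complex" where
  "sph_rot (Fin a) z = (z - a) / (1 + cnj a * z)"
| "sph_rot Infty z = 1 / z"

fun sph_rot_inv :: "csphere \<Rightarrow> complex \<Rightarrow> complex" where
  "sph_rot_inv (Fin a) w = (w + a) / (1 - cnj a * w)"
| "sph_rot_inv Infty w = 1 / w"

fun antipodal :: "csphere \<Rightarrow> complex \<Rightarrow> bool" where
  "antipodal (Fin a) z \<longleftrightarrow> 1 + cnj a * z = 0"
| "antipodal Infty z \<longleftrightarrow> z = 0"

lemma arctan_eq_arcsin: "arctan x = arcsin (x / sqrt (1 + x\<^sup>2))"
  using arctan_lbound[of x] arctan_ubound[of x] arcsin_sin[of "arctan x"] by (simp add: sin_arctan)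

text \<open>Lagrange's identity for the vectors \<open>(z, 1)\<close> and \<open>(a, 1)\<close>:
  squared modulus of the determinant plus that of the Hermitian product. It is the source of the
  isometry properties of \<open>sph_rot (Fin a)\<close>.\<close>

lemma rotation_norm_identity:
  "(cmod (z - a))\<^sup>2 + (cmod (1 + cnj a * z))\<^sup>2 = (1 + (cmod z)\<^sup>2) * (1 + (cmod a)\<^sup>2)"
  unfolding cmod_power2 by (simp add: power2_eq_square algebra_simps)

lemma one_plus_norm_square_pos [simp]: "0 < 1 + (cmod z)\<^sup>2"
  by (simp add: add_pos_nonneg)

lemma one_plus_norm_square_nonzero [simp]: "1 + (cmod z)\<^sup>2 \<noteq> 0"
  using one_plus_norm_square_pos[of z] by (metis less_irrefl)

lemma one_plus_cnj_mult_self_nonzero: "1 + a * cnj a \<noteq> 0"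
proof -
  have "1 + a * cnj a = of_real (1 + (cmod a)\<^sup>2)" by (simp add: complex_norm_square del: of_real_power)
  then show ?thesis using one_plus_norm_square_pos[of a] by (metis less_irrefl of_real_eq_0_iff)
qed

text \<open>The rotation moves \<open>a\<close> to 0, and a point \<open>w\<close> has distance
  \<open>2 * arctan |w|\<close> from 0. For finite centres \<open>rotation_norm_identity\<close>
  turns the arcsine in the distance formula into this arctangent.\<close>

lemma dist_eq_arctan_sph_rot:
  assumes "\<not> antipodal a z"
  shows "dist (Fin z) a = 2 * arctan (cmod (sph_rot a z))"
proof (cases a)
  case (Fin b)
  define D where "D = cmod (1 + cnj b * z)"
  have D: "D > 0" using assms by (simp add: Fin D_def)
  define S where "S = (1 + (cmod z)\<^sup>2) * (1 + (cmod b)\<^sup>2)"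
  have id: "(cmod (z - b))\<^sup>2 + D\<^sup>2 = S" using rotation_norm_identity[of z b] by (simp add: D_def S_def)
  have "1 + (cmod (z - b) / D)\<^sup>2 = S / D\<^sup>2"
    using D id by (simp add: field_simps)
  then have "sqrt (1 + (cmod (z - b) / D)\<^sup>2) = sqrt S / D"
    using D by (simp add: real_sqrt_divide)
  then have "arctan (cmod (z - b) / D) = arcsin (cmod (z - b) / sqrt S)"
    using D by (simp add: arctan_eq_arcsin)
  then show ?thesis
    by (simp add: Fin dist_Fin_Fin norm_divide D_def S_def real_sqrt_mult)
next
  case Infty
  have z: "cmod z > 0" using assms by (simp add: Infty)
  have "1 + (1 / cmod z)\<^sup>2 = (1 + (cmod z)\<^sup>2) / (cmod z)\<^sup>2"
    using z by (simp add: field_simps)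
  then have "sqrt (1 + (1 / cmod z)\<^sup>2) = sqrt (1 + (cmod z)\<^sup>2) / cmod z"
    using z by (simp add: real_sqrt_divide)
  then have "arctan (1 / cmod z) = arcsin (1 / sqrt (1 + (cmod z)\<^sup>2))"
    using z by (simp add: arctan_eq_arcsin)
  then show ?thesis by (simp add: Infty dist_Fin_Infty norm_divide)
qed

text \<open>Since \<open>r < 1 < pi\<close>, this keeps the pole of \<open>sph_rot a\<close> out of
  the punctured disc.\<close>

lemma dist_antipodal:
  assumes "antipodal a z"
  shows "dist (Fin z) a = pi"
proof (cases a)
  case (Fin b)
  have "(cmod (z - b))\<^sup>2 = (1 + (cmod z)\<^sup>2) * (1 + (cmod b)\<^sup>2)"
    using rotation_norm_identity[of z b] assms by (simp add: Fin)
  then have "cmod (z - b) = sqrt ((1 + (cmod z)\<^sup>2) * (1 + (cmod b)\<^sup>2))"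
    by (metis norm_ge_zero real_sqrt_unique)
  moreover have "sqrt ((1 + (cmod z)\<^sup>2) * (1 + (cmod b)\<^sup>2)) > 0" by simp
  ultimately have "cmod (z - b) / sqrt ((1 + (cmod z)\<^sup>2) * (1 + (cmod b)\<^sup>2)) = 1"
    by (metis divide_self less_irrefl)
  then show ?thesis by (simp only: Fin dist_Fin_Fin real_sqrt_mult) simp
qed (use assms in \<open>simp add: dist_Fin_Infty\<close>)

section \<open>Rotations on the punctured disc\<close>

context
  fixes a :: csphere and r :: real
  assumes r: "0 < r" "r < 1" and fin: "Infty \<notin> pdisc a r"
begin

lemma pdisc_not_antipodal:
  assumes "Fin z \<in> pdisc a r"
  shows "\<not> antipodal a z"
  using assms r pi_gt3 dist_antipodal[of a z] by (auto simp: pdisc_def)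

lemma pdisc_dist:
  assumes "Fin z \<in> pdisc a r"
  shows "dist (Fin z) a = 2 * arctan (cmod (sph_rot a z))"
  by (rule dist_eq_arctan_sph_rot[OF pdisc_not_antipodal[OF assms]])

lemma two_arctan_less_iff: "2 * arctan x < r \<longleftrightarrow> x < tan (r / 2)"
proof -
  have "arctan (tan (r / 2)) = r / 2" using r pi_gt3 by (intro arctan_tan) auto
  then show ?thesis using arctan_less_iff[of x "tan (r / 2)"] by auto
qed

lemma sph_rot_pdisc:
  assumes "Fin z \<in> pdisc a r"
  shows "sph_rot a z \<noteq> 0" "cmod (sph_rot a z) < tan (r / 2)"
proof -
  have "0 < 2 * arctan (cmod (sph_rot a z))" "2 * arctan (cmod (sph_rot a z)) < r"
    unfolding pdisc_dist[OF assms, symmetric] using assms by (simp_all add: pdisc_def)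
  then show "sph_rot a z \<noteq> 0" "cmod (sph_rot a z) < tan (r / 2)"
    using two_arctan_less_iff by auto
qed

text \<open>A zero of the denominator forces \<open>|w| = 1 / |b|\<close>, the modulus of the
  rotated point at infinity; then infinity would lie in the punctured disc, contrary to
  \<open>fin\<close>.\<close>

lemma sph_rot_inv_denominator:
  assumes w: "w \<noteq> 0" "cmod w < tan (r / 2)" and a: "a = Fin b"
  shows "1 - cnj b * w \<noteq> 0"
proof
  assume "1 - cnj b * w = 0"
  then have bw: "cnj b * w = 1" by simp
  then have "cmod b * cmod w = 1" by (metis complex_mod_cnj norm_mult norm_one)
  moreover have b0: "b \<noteq> 0" using bw by auto
  ultimately have cw: "cmod w = 1 / cmod b" by (simp add: eq_divide_eq mult.commute)
  have "dist Infty (Fin b) = 2 * arctan (cmod w)"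
    using dist_eq_arctan_sph_rot[of Infty b] b0 by (simp add: dist_commute[of Infty] cw norm_divide)
  then have "Infty \<in> pdisc a r" using w two_arctan_less_iff a by (simp add: pdisc_def)
  then show False using fin by simp
qed

lemma sph_rot_of_inv:
  assumes w: "w \<noteq> 0" "cmod w < tan (r / 2)"
  shows "\<not> antipodal a (sph_rot_inv a w)" "sph_rot a (sph_rot_inv a w) = w"
proof -
  have "\<not> antipodal a (sph_rot_inv a w) \<and> sph_rot a (sph_rot_inv a w) = w"
  proof (cases a)
    case (Fin b)
    define d where "d = 1 - cnj b * w"
    have d: "d \<noteq> 0" using sph_rot_inv_denominator[OF w Fin] by (simp add: d_def)
    have n: "1 + b * cnj b \<noteq> 0" by (rule one_plus_cnj_mult_self_nonzero)
    have 1: "1 + cnj b * ((w + b) / d) = (1 + b * cnj b) / d"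
      using d by (simp add: field_simps) (simp add: d_def algebra_simps)
    have 2: "(w + b) / d - b = w * (1 + b * cnj b) / d"
      using d by (simp add: field_simps) (simp add: d_def algebra_simps)
    show ?thesis using d n 1 2 by (simp add: Fin d_def[symmetric])
  qed (use w in simp)
  then show "\<not> antipodal a (sph_rot_inv a w)" "sph_rot a (sph_rot_inv a w) = w" by auto
qed

lemma sph_rot_inv_pdisc:
  assumes w: "w \<noteq> 0" "cmod w < tan (r / 2)"
  shows "Fin (sph_rot_inv a w) \<in> pdisc a r"
proof -
  have "dist (Fin (sph_rot_inv a w)) a = 2 * arctan (cmod w)"
    using dist_eq_arctan_sph_rot[OF sph_rot_of_inv(1)[OF w]] sph_rot_of_inv(2)[OF w] by simp
  then show ?thesis
    unfolding pdisc_def mem_Collect_eq using w two_arctan_less_iff by simp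
qed

lemma sph_rot_inv_of_rot:
  assumes "Fin z \<in> pdisc a r"
  shows "sph_rot_inv a (sph_rot a z) = z"
proof (cases a)
  case (Fin b)
  define d where "d = 1 + cnj b * z"
  have d: "d \<noteq> 0" using pdisc_not_antipodal[OF assms] by (simp add: Fin d_def)
  have n: "1 + b * cnj b \<noteq> 0" by (rule one_plus_cnj_mult_self_nonzero)
  have 1: "1 - cnj b * ((z - b) / d) = (1 + b * cnj b) / d"
    using d by (simp add: field_simps) (simp add: d_def algebra_simps)
  have 2: "(z - b) / d + b = z * (1 + b * cnj b) / d"
    using d by (simp add: field_simps) (simp add: d_def algebra_simps)
  show ?thesis using d n 1 2 by (simp add: Fin d_def[symmetric])
next
  case Infty
  then show ?thesis using pdisc_not_antipodal[OF assms] by simp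
qed

text \<open>Rotations preserve the spherical metric, so the spherical derivative is 1; this is the
  form that the chain rule for \<open>log_param\<close> uses.\<close>

lemma sph_rot_inv_derivative:
  assumes w: "w \<noteq> 0" "cmod w < tan (r / 2)"
  shows "\<exists>D. (sph_rot_inv a has_field_derivative D) (at w) \<and>
    cmod D / (1 + (cmod (sph_rot_inv a w))\<^sup>2) = 1 / (1 + (cmod w)\<^sup>2)"
proof (cases a)
  case (Fin b)
  define d where "d = 1 - cnj b * w"
  have d: "d \<noteq> 0" using sph_rot_inv_denominator[OF w Fin] by (simp add: d_def)
  have "((\<lambda>w. (w + b) / (1 - cnj b * w)) has_field_derivative (1 * d - (w + b) * (- cnj b)) / (d * d)) (at w)"
    using d unfolding d_def by (auto intro!: derivative_eq_intros)
  moreover have "1 * d - (w + b) * (- cnj b) = of_real (1 + (cmod b)\<^sup>2)"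
    by (simp add: d_def algebra_simps complex_norm_square del: of_real_power)
  moreover have "d * d = d\<^sup>2" by (simp add: power2_eq_square)
  moreover have "sph_rot_inv a = (\<lambda>w. (w + b) / (1 - cnj b * w))" by (simp add: Fin fun_eq_iff)
  ultimately have der: "(sph_rot_inv a has_field_derivative of_real (1 + (cmod b)\<^sup>2) / d\<^sup>2) (at w)" by simp
  define A B where "A = 1 + (cmod w)\<^sup>2" and "B = 1 + (cmod b)\<^sup>2"
  have AB: "A > 0" "B > 0" by (simp_all add: A_def B_def)
  have d2: "(cmod d)\<^sup>2 > 0" using d by simp
  have id: "(cmod (w + b))\<^sup>2 + (cmod d)\<^sup>2 = A * B"
    using rotation_norm_identity[of w "- b"] by (simp add: d_def A_def B_def)
  have "(cmod ((w + b) / d))\<^sup>2 = (cmod (w + b))\<^sup>2 / (cmod d)\<^sup>2"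
    by (simp only: norm_divide power_divide)
  also have "\<dots> = A * B / (cmod d)\<^sup>2 - 1"
    using d2 by (simp add: id[symmetric] add_divide_distrib)
  finally have inv: "1 + (cmod (sph_rot_inv a w))\<^sup>2 = A * B / (cmod d)\<^sup>2"
    by (simp add: Fin d_def)
  have "cmod (of_real B / d\<^sup>2) = B / (cmod d)\<^sup>2"
    using AB by (simp only: norm_divide norm_of_real norm_power abs_of_pos)
  then have "cmod (of_real B / d\<^sup>2) / (1 + (cmod (sph_rot_inv a w))\<^sup>2) = 1 / A"
    unfolding inv using AB d2 by (simp add: divide_simps)
  with der[folded B_def] show ?thesis unfolding A_def by blast
next
  case Infty
  have "((\<lambda>w. 1 / w) has_field_derivative - 1 / w\<^sup>2) (at w)"
    using w by (auto intro!: derivative_eq_intros simp: power2_eq_square)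
  moreover have "sph_rot_inv a = (\<lambda>w. 1 / w)" by (simp add: Infty fun_eq_iff)
  moreover have "cmod (- 1 / w\<^sup>2) / (1 + (cmod (1 / w))\<^sup>2) = 1 / (1 + (cmod w)\<^sup>2)"
    using w one_plus_norm_square_pos[of w] by (simp add: norm_divide norm_power power_divide field_simps)
  ultimately show ?thesis by auto
qed

lemma sph_rot_holomorphic: "sph_rot a holomorphic_on {z. Fin z \<in> pdisc a r}"
proof (cases a)
  case (Fin b)
  have "(\<lambda>z. (z - b) / (1 + cnj b * z)) holomorphic_on {z. Fin z \<in> pdisc a r}"
    using pdisc_not_antipodal by (intro holomorphic_intros) (auto simp: Fin)
  then show ?thesis by (simp add: Fin cong: holomorphic_cong)
next
  case Infty
  have "(\<lambda>z. 1 / z) holomorphic_on {z. Fin z \<in> pdisc a r}"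
    using pdisc_not_antipodal by (intro holomorphic_intros) (auto simp: Infty)
  then show ?thesis by (simp add: Infty cong: holomorphic_cong)
qed

end

text \<open>This pulls open sets of the sphere back to the plane; the distance formula reduces it to
  continuity of \<open>arcsin\<close> at 0.\<close>

lemma continuous_on_Fin: "continuous_on A Fin"
proof (rule continuous_at_imp_continuous_on, rule ballI)
  fix z :: complex
  define q where "q w = cmod (w - z) / (sqrt (1 + (cmod w)\<^sup>2) * sqrt (1 + (cmod z)\<^sup>2))" for w
  have "(q \<longlongrightarrow> cmod (z - z) / (sqrt (1 + (cmod z)\<^sup>2) * sqrt (1 + (cmod z)\<^sup>2))) (at z)"
    unfolding q_def by (intro tendsto_intros) simp
  then have "(q \<longlongrightarrow> 0) (at z)" by simp
  from isCont_tendsto_compose[OF isCont_arcsin[of 0] this]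
  have "((\<lambda>w. 2 * arcsin (q w)) \<longlongrightarrow> 2 * arcsin 0) (at z)" by (intro tendsto_mult tendsto_const) simp_all
  then show "isCont Fin z"
    by (simp add: isCont_def tendsto_dist_iff[of Fin] dist_Fin_Fin q_def)
qed

section \<open>The inverse of a logarithmic tract map as a univalent map\<close>

text \<open>The sheets stay the same: an evenly covered set is replaced by its preimage under
  \<open>Fin\<close>, and the inverse \<open>q\<close> on a sheet by \<open>q\<close> after
  \<open>Fin\<close>. Continuity of \<open>Fin\<close> is enough for both.\<close>

lemma covering_space_logarithmic_tract:
  assumes lt: "logarithmic_tract f U a r"
  shows "covering_space U f {z. Fin z \<in> pdisc a r}"
proof -
  have cov: "covering_space U (\<lambda>z. Fin (f z)) (pdisc a r)" and f: "f holomorphic_on U"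
    using lt by (auto simp: logarithmic_tract_def)
  have cf: "continuous_on U f" by (rule holomorphic_on_imp_continuous_on[OF f])
  have im: "(\<lambda>z. Fin (f z)) ` U = pdisc a r" by (rule covering_space_imp_surjective[OF cov])
  show ?thesis
  proof
    show "continuous_on U f" by (rule cf)
    have "z \<in> f ` U" if "Fin z \<in> pdisc a r" for z
      using that unfolding im[symmetric] by auto
    then show "f ` U = {z. Fin z \<in> pdisc a r}" using im by auto
    fix x assume "x \<in> {z. Fin z \<in> pdisc a r}"
    then have "Fin x \<in> pdisc a r" by simp
    note sheets = bspec[OF conjunct2[OF conjunct2[OF cov[unfolded covering_space_def]]] this]
    obtain T \<V> where T: "Fin x \<in> T" "openin (top_of_set (pdisc a r)) T"
      and \<V>: "\<Union>\<V> = U \<inter> (\<lambda>z. Fin (f z)) -` T" "\<forall>u\<in>\<V>. openin (top_of_set U) u" "pairwise disjnt \<V>"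
        "\<forall>u\<in>\<V>. \<exists>q. homeomorphism u T (\<lambda>z. Fin (f z)) q"
      using sheets by (elim exE conjE) (rule that)
    define T' where "T' = Fin -` T"
    obtain W where W: "open W" "T = pdisc a r \<inter> W" using T(2) by (auto simp: openin_open)
    have "open (Fin -` W)"
      using continuous_on_Fin[of UNIV] W(1) by (simp add: continuous_on_open_vimage)
    moreover have "T' = {z. Fin z \<in> pdisc a r} \<inter> Fin -` W" by (auto simp: T'_def W(2))
    ultimately have opT: "openin (top_of_set {z. Fin z \<in> pdisc a r}) T'" by (auto simp: openin_open)
    have hom: "\<exists>q. homeomorphism u T' f q" if u: "u \<in> \<V>" for u
    proof -
      obtain q where q: "homeomorphism u T (\<lambda>z. Fin (f z)) q" using bspec[OF \<V>(4) u] by blast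
      have uU: "u \<subseteq> U" using \<V>(1) u by auto
      have "homeomorphism u T' f (\<lambda>z. q (Fin z))"
      proof (rule homeomorphismI)
        show "continuous_on u f" by (rule continuous_on_subset[OF cf uU])
        show "continuous_on T' (\<lambda>z. q (Fin z))"
          by (rule continuous_on_compose2[OF homeomorphism_cont2[OF q] continuous_on_Fin]) (auto simp: T'_def)
        show "f ` u \<subseteq> T'"
          using homeomorphism_image1[OF q] by (auto simp: T'_def)
        show "(\<lambda>z. q (Fin z)) ` T' \<subseteq> u"
          using homeomorphism_image2[OF q] by (auto simp: T'_def)
        show "q (Fin (f z)) = z" if "z \<in> u" for z
          using homeomorphism_apply1[OF q that] by simp
        show "f (q (Fin z)) = z" if "z \<in> T'" for z
          using homeomorphism_apply2[OF q, of "Fin z"] that by (simp add: T'_def)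
      qed
      then show ?thesis by blast
    qed
    have "x \<in> T'" "\<Union>\<V> = U \<inter> f -` T'" using T(1) \<V>(1) by (auto simp: T'_def)
    then show "\<exists>T. x \<in> T \<and> openin (top_of_set {z. Fin z \<in> pdisc a r}) T \<and>
        (\<exists>v. \<Union>v = U \<inter> f -` T \<and> (\<forall>u\<in>v. openin (top_of_set U) u) \<and> pairwise disjnt v \<and>
          (\<forall>u\<in>v. \<exists>q. homeomorphism u T f q))"
      using opT \<V>(2,3) hom by (intro exI[of _ T'] exI[of _ \<V>] conjI ballI) simp_all
  qed
qed

text \<open>For finite punctured discs this is the universal covering by the right half-plane.
  \<open>tan (r / 2)\<close> is the radius of the rotated disc, whose points satisfy
  \<open>2 * arctan |w| < r\<close>; the minus sign makes large \<open>Re \<zeta>\<close> correspond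
  to points near \<open>a\<close>.\<close>

definition log_param :: "csphere \<Rightarrow> real \<Rightarrow> complex \<Rightarrow> complex" where
  "log_param a r \<zeta> = sph_rot_inv a (of_real (tan (r / 2)) * exp (- \<zeta>))"

lemma tan_half_pos: "0 < r \<Longrightarrow> r < 1 \<Longrightarrow> 0 < tan (r / 2)" for r :: real
  using pi_gt3 by (intro tan_gt_zero) auto

section \<open>The exponential parametrisation of the punctured disc\<close>

context
  fixes a :: csphere and r :: real
  assumes r: "0 < r" "r < 1" and fin: "Infty \<notin> pdisc a r"
begin

lemma log_param_range:
  assumes "0 < Re \<zeta>"
  shows "of_real (tan (r / 2)) * exp (- \<zeta>) \<noteq> 0"
    and "cmod (of_real (tan (r / 2)) * exp (- \<zeta>)) < tan (r / 2)"
  using assms tan_half_pos[OF r] by (auto simp: norm_mult)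

lemma log_param_pdisc: "0 < Re \<zeta> \<Longrightarrow> Fin (log_param a r \<zeta>) \<in> pdisc a r"
  unfolding log_param_def by (rule sph_rot_inv_pdisc[OF r fin log_param_range])

lemma sph_rot_log_param:
  "0 < Re \<zeta> \<Longrightarrow> sph_rot a (log_param a r \<zeta>) = of_real (tan (r / 2)) * exp (- \<zeta>)"
  unfolding log_param_def by (rule sph_rot_of_inv(2)[OF r fin log_param_range])

lemma dist_log_param:
  assumes "0 < Re \<zeta>"
  shows "dist (Fin (log_param a r \<zeta>)) a = 2 * arctan (tan (r / 2) * exp (- Re \<zeta>))"
  using pdisc_dist[OF r fin log_param_pdisc[OF assms]] tan_half_pos[OF r]
  by (simp add: sph_rot_log_param[OF assms] norm_mult)

lemma log_param_eqD:
  assumes "0 < Re \<zeta>" "0 < Re \<xi>" "log_param a r \<zeta> = log_param a r \<xi>"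
  shows "exp \<zeta> = exp \<xi>"
proof -
  have "of_real (tan (r / 2)) * exp (- \<zeta>) = of_real (tan (r / 2)) * exp (- \<xi>)"
    using sph_rot_log_param assms by metis
  then show ?thesis using tan_half_pos[OF r] by (simp add: exp_minus)
qed

text \<open>The exponential contributes the factor \<open>w\<close>, the rotation the factor
  \<open>1 / (1 + w^2)\<close>. This quotient is comparable to the distance from \<open>a\<close>
  and so gives rise to the distance ratio in the final bounds.\<close>

lemma log_param_derivative:
  assumes "0 < Re \<zeta>"
  defines "w \<equiv> tan (r / 2) * exp (- Re \<zeta>)"
  shows "\<exists>D. (log_param a r has_field_derivative D) (at \<zeta>) \<and>
    cmod D / (1 + (cmod (log_param a r \<zeta>))\<^sup>2) = w / (1 + w\<^sup>2)"
proof -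
  define v where "v = of_real (tan (r / 2)) * exp (- \<zeta>)"
  have v: "v \<noteq> 0" "cmod v < tan (r / 2)" using log_param_range[OF assms(1)] by (auto simp: v_def)
  have vw: "cmod v = w" using tan_half_pos[OF r] by (simp add: v_def w_def norm_mult)
  obtain D where D: "(sph_rot_inv a has_field_derivative D) (at v)"
    "cmod D / (1 + (cmod (sph_rot_inv a v))\<^sup>2) = 1 / (1 + (cmod v)\<^sup>2)"
    using sph_rot_inv_derivative[OF r fin v] by blast
  have "((\<lambda>\<zeta>. of_real (tan (r / 2)) * exp (- \<zeta>)) has_field_derivative - v) (at \<zeta>)"
    by (auto intro!: derivative_eq_intros simp: v_def)
  then have "(log_param a r has_field_derivative D * - v) (at \<zeta>)"
    unfolding log_param_def[abs_def] by (rule DERIV_chain2[where f = "sph_rot_inv a" and x = \<zeta> and g = "\<lambda>\<zeta>. of_real (tan (r / 2)) * exp (- \<zeta>)", OF D(1)[unfolded v_def]])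
  moreover have "log_param a r \<zeta> = sph_rot_inv a v" by (simp add: log_param_def v_def)
  then have "cmod (D * - v) / (1 + (cmod (log_param a r \<zeta>))\<^sup>2) = w * (cmod D / (1 + (cmod (sph_rot_inv a v))\<^sup>2))"
    by (simp add: norm_mult vw)
  then have "cmod (D * - v) / (1 + (cmod (log_param a r \<zeta>))\<^sup>2) = w / (1 + w\<^sup>2)"
    unfolding D(2) vw by simp
  ultimately show ?thesis by blast
qed

lemma log_param_holomorphic: "log_param a r holomorphic_on {\<zeta>. 0 < Re \<zeta>}"
proof -
  have op: "open {z. 0 < Re z}" by (simp add: open_halfspace_Re_gt)
  show ?thesis
    using log_param_derivative holomorphic_on_open[OF op] by blast
qed

text \<open>The function \<open>\<Lambda>\<close> is a logarithm of \<open>f\<close> in the coordinate centred at \<open>a\<close>. Since the lift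
  \<open>F\<close> is a right inverse of it, \<open>F\<close> is injective and holomorphic.\<close>

lemma logarithmic_tract_uniformization:
  assumes lt: "logarithmic_tract f U a r" and u: "u \<in> U"
  obtains F \<zeta>0 where "F holomorphic_on {\<zeta>. 0 < Re \<zeta>}" "inj_on F {\<zeta>. 0 < Re \<zeta>}"
    "\<And>\<zeta>. 0 < Re \<zeta> \<Longrightarrow> F \<zeta> \<in> U" "\<And>\<zeta>. 0 < Re \<zeta> \<Longrightarrow> f (F \<zeta>) = log_param a r \<zeta>"
    "0 < Re \<zeta>0" "F \<zeta>0 = u"
proof -
  define H where "H = {\<zeta>. 0 < Re \<zeta>}"
  have opH: "open H" and convH: "convex H"
    by (simp_all add: H_def open_halfspace_Re_gt convex_halfspace_Re_gt)
  have U: "open U" "simply_connected U" "f holomorphic_on U"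
    using lt by (auto simp: logarithmic_tract_def)
  define V where "V = {z. Fin z \<in> pdisc a r}"
  have cov: "covering_space U f V" unfolding V_def by (rule covering_space_logarithmic_tract[OF lt])
  have fV: "f z \<in> V" if "z \<in> U" for z using covering_space_imp_surjective[OF cov] that by blast
  define R where "R = tan (r / 2)"
  have R: "R > 0" unfolding R_def by (rule tan_half_pos[OF r])
  have "(\<lambda>z. sph_rot a (f z) / of_real R) holomorphic_on U"
    using holomorphic_on_compose_gen[OF U(3) sph_rot_holomorphic[OF r fin]] fV R
    by (intro holomorphic_intros) (auto simp: o_def V_def image_subset_iff)
  \<comment> \<open>The quotient has no zero on the simply connected \<open>U\<close>, hence a
    holomorphic logarithm.\<close>
  then obtain \<Lambda>' where \<Lambda>': "\<Lambda>' holomorphic_on U" "\<And>z. z \<in> U \<Longrightarrow> sph_rot a (f z) / of_real R = exp (\<Lambda>' z)"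
    using simply_connected_imp_holomorphic_log[OF _ U(2) open_imp_locally_path_connected[OF U(1)], of "\<lambda>z. sph_rot a (f z) / of_real R"]
      sph_rot_pdisc(1)[OF r fin] fV R by (auto simp: V_def)
  define \<Lambda> where "\<Lambda> z = - \<Lambda>' z" for z
  have \<Lambda>: "\<Lambda> holomorphic_on U" unfolding \<Lambda>_def by (intro holomorphic_intros \<Lambda>')
  have rotf: "sph_rot a (f z) = of_real R * exp (- \<Lambda> z)" if "z \<in> U" for z
    using \<Lambda>'(2)[OF that] R by (simp add: \<Lambda>_def field_simps)
  have \<Lambda>H: "\<Lambda> z \<in> H" if z: "z \<in> U" for z
  proof -
    have "R * exp (- Re (\<Lambda> z)) = cmod (sph_rot a (f z))" using rotf[OF z] R by (simp add: norm_mult)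
    also have "\<dots> < R" unfolding R_def using sph_rot_pdisc(2)[OF r fin] fV[OF z] by (simp add: V_def)
    finally show ?thesis using R by (simp add: H_def)
  qed
  have f\<Lambda>: "f z = log_param a r (\<Lambda> z)" if z: "z \<in> U" for z
    using sph_rot_inv_of_rot[OF r fin, of "f z"] fV[OF z] rotf[OF z]
    by (simp add: V_def log_param_def R_def)
  have lpV: "log_param a r \<zeta> \<in> V" if "\<zeta> \<in> H" for \<zeta>
    using log_param_pdisc that by (simp add: V_def H_def)
  have contlp: "continuous_on H (log_param a r)"
    unfolding H_def by (rule holomorphic_on_imp_continuous_on[OF log_param_holomorphic])
  \<comment> \<open>The lift of \<open>log_param\<close> through the covering \<open>f\<close> with
    prescribed base point; so far it is only known to be continuous.\<close>
  obtain F where F: "continuous_on H F" "F \<in> H \<rightarrow> U" "F (\<Lambda> u) = u" "\<And>\<zeta>. \<zeta> \<in> H \<Longrightarrow> f (F \<zeta>) = log_param a r \<zeta>"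
  proof (rule covering_space_lift_strong[OF cov u \<Lambda>H[OF u] convex_imp_simply_connected[OF convH]
        open_imp_locally_path_connected[OF opH] contlp])
    show "log_param a r \<in> H \<rightarrow> V" using lpV by blast
    show "log_param a r (\<Lambda> u) = f u" using f\<Lambda>[OF u] by simp
  qed blast
  have FU: "F \<zeta> \<in> U" if "\<zeta> \<in> H" for \<zeta> using F(2) that by blast
  have inv: "\<Lambda> (F \<zeta>) = \<zeta>" if \<zeta>: "\<zeta> \<in> H" for \<zeta>
  proof -
    \<comment> \<open>\<open>g\<close> takes values in the discrete set of multiples of
      \<open>2 * pi * \<i>\<close> and is 0 at the base point, so connectedness of \<open>H\<close>
      makes it vanish.\<close>
    define g where "g \<zeta> = \<Lambda> (F \<zeta>) - \<zeta>" for \<zeta>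
    have contg: "continuous_on H g"
      unfolding g_def
      by (intro continuous_intros continuous_on_compose2[OF holomorphic_on_imp_continuous_on[OF \<Lambda>] F(1)]) (use FU in auto)
    have g1: "exp (g \<zeta>) = 1" if "\<zeta> \<in> H" for \<zeta>
    proof -
      have "exp (\<Lambda> (F \<zeta>)) = exp \<zeta>"
      proof (rule log_param_eqD)
        show "log_param a r (\<Lambda> (F \<zeta>)) = log_param a r \<zeta>"
          by (simp only: f\<Lambda>[OF FU[OF that], symmetric] F(4)[OF that])
      qed (use \<Lambda>H[OF FU[OF that]] that in \<open>simp_all add: H_def\<close>)
      then show ?thesis by (simp add: g_def exp_diff)
    qed
    have "g constant_on H"
    proof (rule continuous_discrete_range_constant[OF convex_connected[OF convH] contg])
      fix x assume x: "x \<in> H"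
      have "1 \<le> norm (g y - g x)" if y: "y \<in> H" "g y \<noteq> g x" for y
      proof (rule ccontr)
        assume "\<not> 1 \<le> norm (g y - g x)"
        then have "\<bar>Im (g y) - Im (g x)\<bar> < 2 * pi"
          using abs_Im_le_cmod[of "g y - g x"] pi_gt3 by simp
        then have "g y = g x" by (rule exp_complex_eqI) (simp add: g1 x y)
        then show False using y by simp
      qed
      then show "\<exists>e>0. \<forall>y. y \<in> H \<and> g y \<noteq> g x \<longrightarrow> e \<le> norm (g y - g x)"
        using zero_less_one by blast
    qed
    then have "g \<zeta> = g (\<Lambda> u)" using \<zeta> \<Lambda>H[OF u] by (auto simp: constant_on_def)
    then show ?thesis by (simp add: g_def F(3))
  qed
  have injF: "inj_on F H" by (metis inj_onI inv)
  \<comment> \<open>With an open image, \<open>F\<close> becomes the inverse of the injective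
    holomorphic restriction of \<open>\<Lambda>\<close> to it; this yields holomorphy of
    \<open>F\<close>.\<close>
  have opF: "open (F ` H)" by (rule invariance_of_domain[OF F(1) opH injF])
  have "inj_on \<Lambda> (F ` H)" using inv by (auto simp: inj_on_def)
  moreover have "\<Lambda> holomorphic_on F ` H" using FU by (intro holomorphic_on_subset[OF \<Lambda>]) auto
  ultimately obtain g where g: "g holomorphic_on \<Lambda> ` F ` H" "\<And>z. z \<in> F ` H \<Longrightarrow> g (\<Lambda> z) = z"
    using holomorphic_has_inverse[OF _ opF] by metis
  have "\<Lambda> ` F ` H = H" using inv by force
  then have "g holomorphic_on H" using g(1) by simp
  moreover have "g \<zeta> = F \<zeta>" if "\<zeta> \<in> H" for \<zeta> using g(2)[of "F \<zeta>"] inv[OF that] that by simp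
  ultimately have "F holomorphic_on H" by (simp cong: holomorphic_cong)
  then show ?thesis
    using that[of F "\<Lambda> u"] injF FU F(3,4) \<Lambda>H[OF u] by (simp add: H_def)
qed

text \<open>Heights in \<open>S\<close> differ by less than \<open>2 * pi\<close>, so
  \<open>log_param\<close> has a holomorphic inverse \<open>\<Phi>\<close> on the image of
  \<open>S\<close>, and \<open>F\<close> after \<open>\<Phi>\<close> is the extension.\<close>

lemma branch_extension_from_strip:
  assumes F: "F holomorphic_on {\<zeta>. 0 < Re \<zeta>}" "\<And>\<zeta>. 0 < Re \<zeta> \<Longrightarrow> F \<zeta> \<in> U"
      "\<And>\<zeta>. 0 < Re \<zeta> \<Longrightarrow> f (F \<zeta>) = log_param a r \<zeta>" "inj_on F {\<zeta>. 0 < Re \<zeta>}"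
    and S: "open S" "connected S" "S \<subseteq> {\<zeta>. 0 < Re \<zeta>}" "\<zeta>0 \<in> S"
      "\<And>\<zeta> \<xi>. \<zeta> \<in> S \<Longrightarrow> \<xi> \<in> S \<Longrightarrow> \<bar>Im \<zeta> - Im \<xi>\<bar> < 2 * pi"
    and g: "inverse_branch f U D g" "z0 \<in> D" "g z0 = F \<zeta>0"
  obtains h where "branch_extension f U z0 g (log_param a r ` S) h" "log_param a r \<zeta>0 = z0"
    "\<And>\<zeta>. \<zeta> \<in> S \<Longrightarrow> sph_deriv h (log_param a r \<zeta>) = sph_density F \<zeta> /
       (tan (r / 2) * exp (- Re \<zeta>) / (1 + (tan (r / 2) * exp (- Re \<zeta>))\<^sup>2))"
proof -
  let ?P = "log_param a r"
  have Spos: "0 < Re \<zeta>" if "\<zeta> \<in> S" for \<zeta> using S(3) that by blast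
  have injP: "inj_on ?P S"
  proof (rule inj_onI)
    fix \<zeta> \<xi> assume "\<zeta> \<in> S" "\<xi> \<in> S" "?P \<zeta> = ?P \<xi>"
    then show "\<zeta> = \<xi>" using log_param_eqD Spos S(5) exp_complex_eqI by metis
  qed
  have holP: "?P holomorphic_on S" by (rule holomorphic_on_subset[OF log_param_holomorphic S(3)])
  obtain \<Phi> where \<Phi>: "\<Phi> holomorphic_on ?P ` S" "\<And>\<zeta>. \<zeta> \<in> S \<Longrightarrow> deriv ?P \<zeta> * deriv \<Phi> (?P \<zeta>) = 1"
    "\<And>\<zeta>. \<zeta> \<in> S \<Longrightarrow> \<Phi> (?P \<zeta>) = \<zeta>"
    using holomorphic_has_inverse[OF holP S(1) injP] by metis
  have opE: "open (?P ` S)" by (rule open_mapping_thm3[OF holP S(1) injP])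
  have connE: "connected (?P ` S)"
    by (rule connected_continuous_image[OF holomorphic_on_imp_continuous_on[OF holP] S(2)])
  define h where "h z = F (\<Phi> z)" for z
  have hP: "h (?P \<zeta>) = F \<zeta>" if "\<zeta> \<in> S" for \<zeta> using \<Phi>(3)[OF that] by (simp add: h_def)
  have "\<Phi> ` ?P ` S \<subseteq> {\<zeta>. 0 < Re \<zeta>}" using \<Phi>(3) S(3) by auto
  then have holh: "h holomorphic_on ?P ` S"
    unfolding h_def using holomorphic_on_compose_gen[OF \<Phi>(1) F(1)] by (simp add: o_def)
  have z0: "?P \<zeta>0 = z0"
    using F(3)[of \<zeta>0] Spos[OF S(4)] g by (auto simp: inverse_branch_def)
  have ib: "inverse_branch f U (?P ` S) h"
    using opE holh hP F(2,3) Spos by (auto simp: inverse_branch_def)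
  have opFS: "open (F ` S)"
    using open_mapping_thm3[OF holomorphic_on_subset[OF F(1) S(3)] S(1) inj_on_subset[OF F(4) S(3)]] .
  have injf: "x = y" if xy: "x \<in> F ` S" "y \<in> F ` S" "f x = f y" for x y
  proof -
    obtain \<zeta> \<xi> where *: "\<zeta> \<in> S" "\<xi> \<in> S" "x = F \<zeta>" "y = F \<xi>" using xy(1,2) by blast
    then have "?P \<zeta> = ?P \<xi>" using xy(3) F(3) Spos by metis
    then show ?thesis using inj_onD[OF injP] * by blast
  qed
  \<comment> \<open>Near \<open>z0\<close> both \<open>h\<close> and \<open>g\<close> are right
    inverses of \<open>f\<close> with values in the image of \<open>S\<close> under
    \<open>F\<close>, on which \<open>f\<close> is injective.\<close>
  have ev: "\<forall>\<^sub>F w in nhds z0. h w = g w"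
  proof -
    have D: "open D" "continuous_on D g"
      using g(1) holomorphic_on_imp_continuous_on by (auto simp: inverse_branch_def)
    have "isCont g z0" using D g(2) by (simp add: continuous_on_eq_continuous_at)
    then have "\<forall>\<^sub>F w in nhds z0. g w \<in> F ` S"
      using opFS S(4) g(3) by (simp add: isCont_def tendsto_nhds_iff topological_tendstoD eventually_nhds_conv_at tendsto_def)
    moreover have "\<forall>\<^sub>F w in nhds z0. w \<in> D" using D g(2) by (simp add: eventually_nhds_in_open)
    moreover have "\<forall>\<^sub>F w in nhds z0. w \<in> ?P ` S"
      using opE S(4) z0 by (intro eventually_nhds_in_open) auto
    ultimately show ?thesis
    proof eventually_elim
      case (elim w)
      then have "h w \<in> F ` S" using hP by auto
      moreover have "f (h w) = w" using ib elim by (auto simp: inverse_branch_def)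
      moreover have "f (g w) = w" using g(1) elim by (auto simp: inverse_branch_def)
      ultimately show ?case using injf elim by auto
    qed
  qed
  have be: "branch_extension f U z0 g (?P ` S) h"
    using ib connE S(4) z0 ev by (auto simp: branch_extension_def)
  have sd: "sph_deriv h (?P \<zeta>) = sph_density F \<zeta> /
       (tan (r / 2) * exp (- Re \<zeta>) / (1 + (tan (r / 2) * exp (- Re \<zeta>))\<^sup>2))" if \<zeta>: "\<zeta> \<in> S" for \<zeta>
  proof -
    obtain D where D: "(?P has_field_derivative D) (at \<zeta>)"
      "cmod D / (1 + (cmod (?P \<zeta>))\<^sup>2) = tan (r / 2) * exp (- Re \<zeta>) / (1 + (tan (r / 2) * exp (- Re \<zeta>))\<^sup>2)"
      using log_param_derivative[OF Spos[OF \<zeta>]] by blast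
    have dP: "deriv ?P \<zeta> = D" by (rule DERIV_imp_deriv[OF D(1)])
    have D0: "D \<noteq> 0" using \<Phi>(2)[OF \<zeta>] dP by auto
    have "(\<Phi> has_field_derivative deriv \<Phi> (?P \<zeta>)) (at (?P \<zeta>))"
      using holomorphic_derivI[OF \<Phi>(1) opE] \<zeta> by blast
    moreover have "(F has_field_derivative deriv F \<zeta>) (at \<zeta>)"
      using holomorphic_derivI[OF F(1)] Spos[OF \<zeta>] by (simp add: open_halfspace_Re_gt)
    ultimately have "(h has_field_derivative deriv F \<zeta> * deriv \<Phi> (?P \<zeta>)) (at (?P \<zeta>))"
      unfolding h_def using \<Phi>(3)[OF \<zeta>] by (intro DERIV_chain2[where f = F]) auto
    moreover have "deriv \<Phi> (?P \<zeta>) = 1 / D" using \<Phi>(2)[OF \<zeta>] dP D0 by (simp add: field_simps)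
    ultimately have "deriv h (?P \<zeta>) = deriv F \<zeta> / D" by (simp add: DERIV_imp_deriv)
    then have "sph_deriv h (?P \<zeta>) = sph_density F \<zeta> / (cmod D / (1 + (cmod (?P \<zeta>))\<^sup>2))"
      by (simp add: sph_deriv_def sph_density_def hP[OF \<zeta>] norm_divide mult.commute)
    then show ?thesis unfolding D(2) .
  qed
  show ?thesis by (rule that[OF be z0 sd])
qed

end

section \<open>Comparison of the coordinate with the spherical distance\<close>

lemma arctan_ge_divide_one_plus_square: "u / (1 + u\<^sup>2) \<le> arctan u" if "0 \<le> u" for u :: real
proof -
  have "u / (1 + u\<^sup>2) = sin (arctan u) * cos (arctan u)"
    by (simp add: sin_arctan cos_arctan add_nonneg_nonneg)
  also have "\<dots> = sin (2 * arctan u) / 2" by (simp add: sin_double)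
  also have "\<dots> \<le> arctan u" using sin_x_le_x[of "2 * arctan u"] that by simp
  finally show ?thesis .
qed

text \<open>\<open>arctan x / x\<close> decreases. With \<open>v = tan (r / 2)\<close>, where
  \<open>arctan v = r / 2\<close>, this bounds the distance from below by
  \<open>r * exp (- x)\<close>.\<close>

lemma arctan_scale_ge:
  fixes u v :: real
  assumes "0 < u" "u \<le> v"
  shows "u / v * arctan v \<le> arctan u"
proof -
  have "arctan v / v \<le> arctan u / u"
  proof (rule DERIV_nonpos_imp_nonincreasing[OF assms(2)])
    fix x assume "u \<le> x" "x \<le> v"
    then have x: "0 < x" using assms by simp
    have "((\<lambda>x. arctan x / x) has_real_derivative (x / (1 + x\<^sup>2) - arctan x) / (x * x)) (at x)"
      using x by (auto intro!: derivative_eq_intros simp: inverse_eq_divide)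
    moreover have "(x / (1 + x\<^sup>2) - arctan x) / (x * x) \<le> 0"
      using arctan_ge_divide_one_plus_square[of x] x by (intro divide_nonpos_pos) auto
    ultimately show "\<exists>y. ((\<lambda>x. arctan x / x) has_real_derivative y) (at x) \<and> y \<le> 0" by blast
  qed
  then show ?thesis using assms by (simp add: field_simps)
qed

text \<open>The estimates of \<open>x\<close> rest on
  \<open>r * exp (- x) \<le> d \<le> 2 * exp (- x)\<close>, that is
  \<open>ln (r / d) \<le> x \<le> ln (2 / d)\<close>. As \<open>d \<le> lam * r < 1\<close> keeps
  \<open>ln (1 / d)\<close> above the positive number \<open>Lmin\<close>, the additive constants
  can be absorbed into factors.\<close>

lemma sphere_distance_estimates:
  fixes r lam x :: real
  assumes r: "0 < r" "r < 1" and lam: "0 < lam" "lam < 1" and x: "0 < x"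
  defines "w \<equiv> tan (r / 2) * exp (- x)" and "Lmin \<equiv> ln (1 / (lam * r))"
  defines "d \<equiv> 2 * arctan w"
  shows "0 < d" "d / 4 \<le> w / (1 + w\<^sup>2)" "w / (1 + w\<^sup>2) \<le> d / 2"
    and "d \<le> lam * r \<Longrightarrow> ln (1 / lam) \<le> x"
    and "d \<le> lam * r \<Longrightarrow> Lmin \<le> ln (1 / d)"
    and "d \<le> lam * r \<Longrightarrow> ln (1 / lam) / Lmin * ln (1 / d) \<le> x"
    and "d \<le> lam * r \<Longrightarrow> x \<le> (1 + ln 2 / Lmin) * ln (1 / d)"
proof -
  define R where "R = tan (r / 2)"
  have R0: "0 < R" unfolding R_def by (rule tan_half_pos[OF r])
  have "tan (r / 2) < tan (pi / 4)" using r pi_gt3 by (intro tan_monotone) auto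
  then have R1: "R \<le> 1" by (simp add: R_def tan_45)
  have aR: "arctan R = r / 2" unfolding R_def using r pi_gt3 by (intro arctan_tan) auto
  have w0: "0 < w" and wR: "w \<le> R" using R0 x by (simp_all add: w_def R_def[symmetric])
  show d0: "0 < d" using w0 by (simp add: d_def)
  have dw: "d \<le> 2 * w" using arctan_le_self[of w] w0 by (simp add: d_def)
  show "w / (1 + w\<^sup>2) \<le> d / 2" using arctan_ge_divide_one_plus_square[of w] w0 by (simp add: d_def)
  have "w\<^sup>2 \<le> 1" using w0 wR R1 by (simp add: power_le_one)
  have "d / 4 \<le> w / 2" using dw by simp
  also have "w / 2 \<le> w / (1 + w\<^sup>2)"
    using w0 \<open>w\<^sup>2 \<le> 1\<close> by (intro divide_left_mono) (auto simp: add_pos_nonneg)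
  finally show "d / 4 \<le> w / (1 + w\<^sup>2)" .
  have "w / R = exp (- x)" using R0 by (simp add: w_def R_def)
  then have "exp (- x) * r \<le> d" using arctan_scale_ge[OF w0 wR] by (simp add: aR d_def)
  then have "r / d \<le> exp x" using d0 by (simp add: exp_minus field_simps)
  then have "ln (r / d) \<le> ln (exp x)" using d0 r by (subst ln_le_cancel_iff) auto
  then have xlow: "ln (r / d) \<le> x" by simp
  have "d \<le> 2 * (1 * exp (- x))" using dw R1 unfolding w_def R_def[symmetric]
    by (meson dual_order.trans exp_ge_zero mult_left_mono mult_right_mono zero_le_numeral)
  then have "exp x \<le> 2 / d" using d0 by (simp add: exp_minus field_simps)
  then have xup: "x \<le> ln (2 / d)" using d0 by (simp add: ln_ge_iff)
  have l1: "ln (1 / lam) > 0" using lam by simp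
  have Lm: "Lmin = ln (1 / lam) + ln (1 / r)" using lam r by (simp add: Lmin_def ln_div ln_mult)
  have lr: "ln (1 / r) > 0" using r by simp
  have Lm0: "Lmin > 0" using Lm l1 lr by simp
  {
    assume dl: "d \<le> lam * r"
    have "1 / lam \<le> r / d" using dl d0 lam by (simp add: field_simps)
    then have "ln (1 / lam) \<le> ln (r / d)" using lam d0 r by (subst ln_le_cancel_iff) auto
    then show "ln (1 / lam) \<le> x" using xlow by simp
    have "1 / (lam * r) \<le> 1 / d" using dl d0 lam r by (intro divide_left_mono) auto
    then show LL: "Lmin \<le> ln (1 / d)" unfolding Lmin_def using lam d0 r by (subst ln_le_cancel_iff) auto
    \<comment> \<open>Since \<open>Lmin = ln (1 / lam) + ln (1 / r)\<close>, subtracting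
      \<open>ln (1 / r)\<close> costs at most the fraction \<open>ln (1 / r) / Lmin\<close> of
      \<open>ln (1 / d)\<close>.\<close>
    have "ln (1 / r) * Lmin \<le> ln (1 / r) * ln (1 / d)" using LL lr by (intro mult_left_mono) auto
    then have "ln (1 / lam) * ln (1 / d) \<le> (ln (1 / d) - ln (1 / r)) * Lmin" by (simp add: Lm algebra_simps)
    moreover have "ln (1 / d) - ln (1 / r) = ln (r / d)" using d0 r by (simp add: ln_div)
    ultimately have "ln (1 / lam) * ln (1 / d) \<le> x * Lmin"
      using xlow Lm0 by (metis (no_types, lifting) less_eq_real_def mult_right_mono order.trans)
    then show "ln (1 / lam) / Lmin * ln (1 / d) \<le> x" using Lm0 by (simp add: field_simps)
    have "ln 2 * 1 \<le> ln 2 * (ln (1 / d) / Lmin)" using LL Lm0 by (intro mult_left_mono) auto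
    moreover have "ln (2 / d) = ln 2 + ln (1 / d)" using d0 by (simp add: ln_div)
    ultimately show "x \<le> (1 + ln 2 / Lmin) * ln (1 / d)" using xup by (simp add: algebra_simps)
  }
qed

text \<open>The 2 compares \<open>w / (1 + w^2)\<close> with the distance, the exponential is the
  cost of the vertical segment for \<open>\<delta> = ln (1 / lam)\<close>, and the quotient compares
  \<open>x\<close> with \<open>ln (1 / d)\<close> in both directions; the cube comes from the
  exponent -3.\<close>

definition distortion_constant :: "real \<Rightarrow> real \<Rightarrow> real" where
  "distortion_constant r lam = 2 * exp (6 * pi / ln (1 / lam)) *
     ((1 + ln 2 / ln (1 / (lam * r))) / (ln (1 / lam) / ln (1 / (lam * r)))) ^ 3"

lemma distortion_bounds_from_density:
  fixes r lam x1 x2 \<rho> :: real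
  assumes r: "0 < r" "r < 1" and lam: "0 < lam" "lam < 1" and x: "0 < x1" "0 < x2"
  defines "w \<equiv> \<lambda>x. tan (r / 2) * exp (- x)"
  defines "d \<equiv> \<lambda>x. 2 * arctan (w x)"
  defines "S \<equiv> \<lambda>x. w x / (1 + (w x)\<^sup>2)"
  assumes dd: "d x1 \<le> d x2" "d x2 \<le> lam * r"
    and low: "exp (- (6 * pi / ln (1 / lam))) * (x1 / x2) powi (-3) \<le> \<rho>"
    and up: "\<rho> \<le> exp (6 * pi / ln (1 / lam)) * (x1 / x2)"
  shows "inverse (distortion_constant r lam) * (d x2 / d x1) * (ln (1 / d x1) / ln (1 / d x2)) powi (-3) \<le> \<rho> * (S x2 / S x1)"
    and "\<rho> * (S x2 / S x1) \<le> distortion_constant r lam * (d x2 / d x1) * (ln (1 / d x1) / ln (1 / d x2))"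
proof -
  define Lmin k K where "Lmin = ln (1 / (lam * r))" and "k = ln (1 / lam) / Lmin" and "K = 1 + ln 2 / Lmin"
  define e where "e = exp (6 * pi / ln (1 / lam))"
  define L where "L x = ln (1 / d x)" for x
  have folds: "tan (r / 2) * exp (- x) = w x" "2 * arctan (w x) = d x" "w x / (1 + (w x)\<^sup>2) = S x"
    "ln (1 / d x) = L x" "ln (1 / (lam * r)) = Lmin" "ln (1 / lam) / Lmin = k" "1 + ln 2 / Lmin = K" for x
    by (simp_all only: w_def d_def S_def L_def Lmin_def k_def K_def)
  note est1 = sphere_distance_estimates[OF r lam x(1), unfolded folds]
    and est2 = sphere_distance_estimates[OF r lam x(2), unfolded folds]
  have dl1: "d x1 \<le> lam * r" using dd by simp
  have l1: "ln (1 / lam) > 0" and lr: "ln (1 / r) > 0" using lam r by simp_all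
  have Lm: "Lmin = ln (1 / lam) + ln (1 / r)" using lam r by (simp add: Lmin_def ln_div ln_mult)
  have Lm0: "Lmin > 0" using Lm l1 lr by simp
  have k: "0 < k" "k \<le> 1" using l1 Lm0 lr by (simp_all add: k_def Lm)
  have K: "1 \<le> K" using Lm0 by (simp add: K_def)
  define q where "q = K / k"
  have q: "1 \<le> q" using k K by (simp add: q_def)
  have c: "distortion_constant r lam = 2 * e * q ^ 3"
    by (simp only: distortion_constant_def e_def q_def K_def k_def Lmin_def)
  have L: "0 < L x1" "0 < L x2"
    using est1(5)[OF dl1] est2(5)[OF dd(2)] Lm0 by simp_all
  have S: "0 < S x1" "0 < S x2" using est1(1,2) est2(1,2) by simp_all
  have d0: "0 < d x1" "0 < d x2" using est1(1) est2(1) .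
  have S_up: "S x2 / S x1 \<le> 2 * (d x2 / d x1)"
  proof -
    have "S x2 / S x1 \<le> (d x2 / 2) / (d x1 / 4)" using est1(1,2) est2(3) S d0 by (intro frac_le) auto
    then show ?thesis by simp
  qed
  have S_low: "d x2 / d x1 / 2 \<le> S x2 / S x1"
  proof -
    have "(d x2 / 4) / (d x1 / 2) \<le> S x2 / S x1" using est1(3) est2(2) S d0 by (intro frac_le) auto
    then show ?thesis by simp
  qed
  \<comment> \<open>This single estimate serves both bounds, since the power -3 reverses it.\<close>
  have ratio: "x1 / x2 \<le> q * (L x1 / L x2)"
  proof -
    have "x1 / x2 \<le> (K * L x1) / (k * L x2)"
      using est1(7)[OF dl1] est2(6)[OF dd(2)] k K L by (intro frac_le) auto
    then show ?thesis by (simp add: q_def)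
  qed
  have e0: "0 < e" by (simp add: e_def)
  \<comment> \<open>The upper bound would hold with \<open>q\<close>; it is weakened to the cube so
    that one constant fits both sides.\<close>
  have q3: "q \<le> q ^ 3" using q by (simp add: self_le_power)
  have rho0: "0 \<le> \<rho>"
  proof -
    have "0 \<le> exp (- (6 * pi / ln (1 / lam))) * (x1 / x2) powi (-3)" using x by simp
    then show ?thesis using low by linarith
  qed
  have "\<rho> * (S x2 / S x1) \<le> (e * (q ^ 3 * (L x1 / L x2))) * (2 * (d x2 / d x1))"
  proof (rule mult_mono[OF _ S_up])
    have "x1 / x2 \<le> q ^ 3 * (L x1 / L x2)"
      using ratio mult_right_mono[OF q3, of "L x1 / L x2"] L by simp
    then show "\<rho> \<le> e * (q ^ 3 * (L x1 / L x2))"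
      using up e0 unfolding e_def[symmetric] by (meson dual_order.trans less_imp_le mult_left_mono)
    show "0 \<le> e * (q ^ 3 * (L x1 / L x2))" using e0 q L by simp
    show "0 \<le> S x2 / S x1" using S by simp
  qed
  then show "\<rho> * (S x2 / S x1) \<le> distortion_constant r lam * (d x2 / d x1) * (ln (1 / d x1) / ln (1 / d x2))"
    unfolding c L_def[symmetric] by (simp add: mult_ac)
  have "inverse e * inverse (q ^ 3) * (L x1 / L x2) powi (-3) * (d x2 / d x1 / 2) \<le> \<rho> * (S x2 / S x1)"
  proof (rule mult_mono[OF _ S_low])
    have "(x1 / x2) ^ 3 \<le> (q * (L x1 / L x2)) ^ 3" using ratio x by (intro power_mono) auto
    then have "inverse ((q * (L x1 / L x2)) ^ 3) \<le> inverse ((x1 / x2) ^ 3)"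
      using x by (intro le_imp_inverse_le) auto
    then have "inverse (q ^ 3) * inverse ((L x1 / L x2) ^ 3) \<le> inverse ((x1 / x2) ^ 3)"
      by (simp only: power_mult_distrib inverse_mult_distrib)
    then have "inverse e * (inverse (q ^ 3) * inverse ((L x1 / L x2) ^ 3)) \<le> inverse e * inverse ((x1 / x2) ^ 3)"
      using e0 by (intro mult_left_mono) simp_all
    also have "\<dots> \<le> \<rho>" using low by (simp add: e_def power_int_minus exp_minus)
    finally show "inverse e * inverse (q ^ 3) * (L x1 / L x2) powi (-3) \<le> \<rho>"
      by (simp add: power_int_minus mult.assoc)
  qed (use rho0 d0 in auto)
  then show "inverse (distortion_constant r lam) * (d x2 / d x1) * (ln (1 / d x1) / ln (1 / d x2)) powi (-3) \<le> \<rho> * (S x2 / S x1)"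
    unfolding c L_def[symmetric] by (simp add: mult_ac)
qed

section \<open>Distortion of the branches\<close>

lemma distortion_bounds_log_param:
  assumes r: "0 < r" "r < 1" and lam: "0 < lam" "lam < 1" and fin: "Infty \<notin> pdisc a r"
    and F: "F holomorphic_on {\<zeta>. 0 < Re \<zeta>}" "inj_on F {\<zeta>. 0 < Re \<zeta>}"
      "\<And>\<zeta>. 0 < Re \<zeta> \<Longrightarrow> F \<zeta> \<noteq> 0"
    and h: "\<And>\<zeta>. \<zeta> \<in> {\<zeta>1, \<zeta>2} \<Longrightarrow> sph_deriv h (log_param a r \<zeta>) = sph_density F \<zeta> /
       (tan (r / 2) * exp (- Re \<zeta>) / (1 + (tan (r / 2) * exp (- Re \<zeta>))\<^sup>2))"
    and \<zeta>: "0 < Re \<zeta>1" "0 < Re \<zeta>2" "\<bar>Im \<zeta>1 - Im \<zeta>2\<bar> \<le> 2 * pi"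
    and le: "dist (Fin (log_param a r \<zeta>1)) a \<le> dist (Fin (log_param a r \<zeta>2)) a"
      "dist (Fin (log_param a r \<zeta>2)) a \<le> lam * r"
  shows "distortion_bounds (distortion_constant r lam) a h (log_param a r \<zeta>1) (log_param a r \<zeta>2)"
proof -
  have R: "0 < tan (r / 2)" by (rule tan_half_pos[OF r])
  have d: "dist (Fin (log_param a r \<zeta>)) a = 2 * arctan (tan (r / 2) * exp (- Re \<zeta>))" if "0 < Re \<zeta>" for \<zeta>
    by (rule dist_log_param[OF r fin that])
  have le1: "2 * arctan (tan (r / 2) * exp (- Re \<zeta>1)) \<le> 2 * arctan (tan (r / 2) * exp (- Re \<zeta>2))"
    and le2: "2 * arctan (tan (r / 2) * exp (- Re \<zeta>2)) \<le> lam * r"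
    using le by (simp_all only: d[OF \<zeta>(1)] d[OF \<zeta>(2)])
  have x12: "Re \<zeta>2 \<le> Re \<zeta>1" using le1 R by (simp add: arctan_le_iff)
  \<comment> \<open>Here \<open>lam < 1\<close> matters: the margin to the boundary circle keeps the
    real parts away from 0.\<close>
  have \<delta>: "0 < ln (1 / lam)" "ln (1 / lam) \<le> Re \<zeta>2"
    using sphere_distance_estimates(4)[OF r lam \<zeta>(2) le2] lam by simp_all
  note D = sph_density_univalent_halfplane[OF F \<delta> x12 \<zeta>(3)]
  note B = distortion_bounds_from_density[OF r lam \<zeta>(1,2) le1 le2 D]
  have q: "sph_deriv h (log_param a r \<zeta>1) / sph_deriv h (log_param a r \<zeta>2) =
    sph_density F \<zeta>1 / sph_density F \<zeta>2 *
     (tan (r / 2) * exp (- Re \<zeta>2) / (1 + (tan (r / 2) * exp (- Re \<zeta>2))\<^sup>2) /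
      (tan (r / 2) * exp (- Re \<zeta>1) / (1 + (tan (r / 2) * exp (- Re \<zeta>1))\<^sup>2)))"
    unfolding h[of \<zeta>1, simplified] h[of \<zeta>2, simplified] by (simp only: divide_divide_times_eq times_divide_times_eq mult_ac)
  show ?thesis
    unfolding distortion_bounds_def Let_def q d[OF \<zeta>(1)] d[OF \<zeta>(2)] using B by blast
qed

section \<open>Strips and the choice of the extension\<close>

lemma strip_open_convex:
  "open {\<zeta>. 0 < Re \<zeta> \<and> b < Im \<zeta> \<and> Im \<zeta> < c}" "convex {\<zeta>. 0 < Re \<zeta> \<and> b < Im \<zeta> \<and> Im \<zeta> < c}"
proof -
  have "{\<zeta>. 0 < Re \<zeta> \<and> b < Im \<zeta> \<and> Im \<zeta> < c} = {\<zeta>. 0 < Re \<zeta>} \<inter> {\<zeta>. b < Im \<zeta>} \<inter> {\<zeta>. Im \<zeta> < c}" by auto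
  then show "open {\<zeta>. 0 < Re \<zeta> \<and> b < Im \<zeta> \<and> Im \<zeta> < c}" "convex {\<zeta>. 0 < Re \<zeta> \<and> b < Im \<zeta> \<and> Im \<zeta> < c}"
    by (auto intro!: open_Int convex_Int open_halfspace_Re_gt open_halfspace_Im_gt open_halfspace_Im_lt
        convex_halfspace_Re_gt convex_halfspace_Im_gt convex_halfspace_Im_lt)
qed

text \<open>The principal logarithm yields a half-open window of heights of length
  \<open>2 * pi\<close>; the factor \<open>exp (\<i> * of_real y)\<close> centres this window at
  \<open>y\<close>.\<close>

lemma log_param_surj:
  assumes r: "0 < r" "r < 1" and fin: "Infty \<notin> pdisc a r" and z: "Fin z \<in> pdisc a r"
  obtains \<zeta> where "0 < Re \<zeta>" "y - pi \<le> Im \<zeta>" "Im \<zeta> < y + pi" "log_param a r \<zeta> = z"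
proof -
  have R: "0 < tan (r / 2)" by (rule tan_half_pos[OF r])
  define w where "w = sph_rot a z / of_real (tan (r / 2))"
  have w: "w \<noteq> 0" "cmod w < 1"
    using sph_rot_pdisc[OF r fin z] R by (simp_all add: w_def norm_divide)
  define v where "v = w * exp (\<i> * of_real y)"
  have v: "v \<noteq> 0" "cmod v < 1" using w by (simp_all add: v_def norm_mult)
  define \<zeta> where "\<zeta> = \<i> * of_real y - Ln v"
  have "exp (- \<zeta>) = v * exp (- (\<i> * of_real y))"
    using v by (simp add: \<zeta>_def exp_diff exp_minus field_simps)
  also have "\<dots> = w" by (simp add: v_def exp_minus)
  finally have "log_param a r \<zeta> = sph_rot_inv a (sph_rot a z)"
    using R by (simp add: log_param_def w_def)
  then have "log_param a r \<zeta> = z" by (simp add: sph_rot_inv_of_rot[OF r fin z])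
  moreover have "0 < Re \<zeta>" using v by (simp add: \<zeta>_def)
  moreover have "y - pi \<le> Im \<zeta>" "Im \<zeta> < y + pi"
    using Im_Ln_le_pi[OF v(1)] mpi_less_Im_Ln[OF v(1)] by (simp_all add: \<zeta>_def)
  ultimately show ?thesis using that by blast
qed

text \<open>Two strips of width \<open>2 * pi\<close> around the base point are needed because each of them only
  parametrises a slit disc.\<close>

lemma two_branch_extensions:
  assumes r: "0 < r" "r < 1" and lam: "0 < lam" "lam < 1"
    and lt: "logarithmic_tract f U a r" and nz: "0 \<notin> U"
    and g: "inverse_branch f U D g" "z0 \<in> D"
  defines "c \<equiv> distortion_constant r lam"
  obtains E1 g1 E2 g2 where "branch_extension f U z0 g E1 g1" "branch_extension f U z0 g E2 g2"
    "\<And>z. Fin z \<in> pdisc a r \<Longrightarrow> dist (Fin z0) a \<le> dist (Fin z) a \<Longrightarrow> dist (Fin z) a \<le> lam * r \<Longrightarrow>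
      z \<in> E1 \<and> distortion_bounds c a g1 z0 z \<or> z \<in> E2 \<and> distortion_bounds c a g2 z0 z"
    "\<And>z. Fin z \<in> pdisc a r \<Longrightarrow> dist (Fin z) a \<le> dist (Fin z0) a \<Longrightarrow> dist (Fin z0) a \<le> lam * r \<Longrightarrow>
      z \<in> E1 \<and> distortion_bounds c a g1 z z0 \<or> z \<in> E2 \<and> distortion_bounds c a g2 z z0"
proof -
  have fin: "Infty \<notin> pdisc a r" by (rule logarithmic_tract_finite[OF lt])
  have gU: "g z0 \<in> U" using g by (auto simp: inverse_branch_def)
  obtain F \<zeta>0 where F: "F holomorphic_on {\<zeta>. 0 < Re \<zeta>}" "inj_on F {\<zeta>. 0 < Re \<zeta>}"
    "\<And>\<zeta>. 0 < Re \<zeta> \<Longrightarrow> F \<zeta> \<in> U" "\<And>\<zeta>. 0 < Re \<zeta> \<Longrightarrow> f (F \<zeta>) = log_param a r \<zeta>"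
    and \<zeta>0: "0 < Re \<zeta>0" "F \<zeta>0 = g z0"
    by (rule logarithmic_tract_uniformization[OF r fin lt gU]) blast
  have F0: "F \<zeta> \<noteq> 0" if "0 < Re \<zeta>" for \<zeta> using F(3)[OF that] nz by metis
  define S where "S \<beta> = {\<zeta>. 0 < Re \<zeta> \<and> Im \<zeta>0 + \<beta> < Im \<zeta> \<and> Im \<zeta> < Im \<zeta>0 + \<beta> + 2 * pi}" for \<beta>
  have ext: "\<exists>h. branch_extension f U z0 g (log_param a r ` S \<beta>) h \<and>
     (\<forall>\<zeta>\<in>S \<beta>. (dist (Fin z0) a \<le> dist (Fin (log_param a r \<zeta>)) a \<and> dist (Fin (log_param a r \<zeta>)) a \<le> lam * r \<longrightarrow>
          distortion_bounds c a h z0 (log_param a r \<zeta>)) \<and>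
        (dist (Fin (log_param a r \<zeta>)) a \<le> dist (Fin z0) a \<and> dist (Fin z0) a \<le> lam * r \<longrightarrow>
          distortion_bounds c a h (log_param a r \<zeta>) z0))"
    if \<beta>: "- (2 * pi) < \<beta>" "\<beta> < 0" for \<beta>
  proof -
    have \<zeta>0S: "\<zeta>0 \<in> S \<beta>" using \<zeta>0 \<beta> by (simp add: S_def)
    have S: "open (S \<beta>)" "connected (S \<beta>)" "S \<beta> \<subseteq> {\<zeta>. 0 < Re \<zeta>}"
      unfolding S_def using strip_open_convex convex_connected[OF strip_open_convex(2)] by auto
    have Im: "\<bar>Im \<zeta> - Im \<xi>\<bar> < 2 * pi" if "\<zeta> \<in> S \<beta>" "\<xi> \<in> S \<beta>" for \<zeta> \<xi>
      using that by (auto simp: S_def)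
    obtain h where h: "branch_extension f U z0 g (log_param a r ` S \<beta>) h" "log_param a r \<zeta>0 = z0"
      "\<And>\<zeta>. \<zeta> \<in> S \<beta> \<Longrightarrow> sph_deriv h (log_param a r \<zeta>) = sph_density F \<zeta> /
         (tan (r / 2) * exp (- Re \<zeta>) / (1 + (tan (r / 2) * exp (- Re \<zeta>))\<^sup>2))"
      by (rule branch_extension_from_strip[OF r fin F(1,3,4,2) S \<zeta>0S Im g \<zeta>0(2)[symmetric]]) (assumption | rule that)+
    have bounds: "distortion_bounds c a h (log_param a r \<zeta>) (log_param a r \<xi>)"
      if "\<zeta> \<in> S \<beta>" "\<xi> \<in> S \<beta>" "dist (Fin (log_param a r \<zeta>)) a \<le> dist (Fin (log_param a r \<xi>)) a"
        "dist (Fin (log_param a r \<xi>)) a \<le> lam * r" for \<zeta> \<xi>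
      unfolding c_def
      by (rule distortion_bounds_log_param[OF r lam fin F(1,2) F0 h(3)])
        (use that Im[OF that(1,2)] S(3) in auto)
    show ?thesis
      using h(1) bounds[OF \<zeta>0S] bounds[OF _ \<zeta>0S] unfolding h(2) by blast
  qed
  \<comment> \<open>The first strip is centred at \<open>Im \<zeta>0\<close> and misses the heights
    \<open>Im \<zeta>0 - pi\<close> and \<open>Im \<zeta>0 + pi\<close>; the second is shifted up by
    \<open>pi / 2\<close> and contains the latter.\<close>
  obtain h1 h2 where h1: "branch_extension f U z0 g (log_param a r ` S (- pi)) h1"
     "\<forall>\<zeta>\<in>S (- pi). (dist (Fin z0) a \<le> dist (Fin (log_param a r \<zeta>)) a \<and> dist (Fin (log_param a r \<zeta>)) a \<le> lam * r \<longrightarrow>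
          distortion_bounds c a h1 z0 (log_param a r \<zeta>)) \<and>
        (dist (Fin (log_param a r \<zeta>)) a \<le> dist (Fin z0) a \<and> dist (Fin z0) a \<le> lam * r \<longrightarrow>
          distortion_bounds c a h1 (log_param a r \<zeta>) z0)"
    and h2: "branch_extension f U z0 g (log_param a r ` S (- pi / 2)) h2"
     "\<forall>\<zeta>\<in>S (- pi / 2). (dist (Fin z0) a \<le> dist (Fin (log_param a r \<zeta>)) a \<and> dist (Fin (log_param a r \<zeta>)) a \<le> lam * r \<longrightarrow>
          distortion_bounds c a h2 z0 (log_param a r \<zeta>)) \<and>
        (dist (Fin (log_param a r \<zeta>)) a \<le> dist (Fin z0) a \<and> dist (Fin z0) a \<le> lam * r \<longrightarrow>
          distortion_bounds c a h2 (log_param a r \<zeta>) z0)"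
    using ext[of "- pi"] ext[of "- pi / 2"] by auto
  have cover: "z \<in> log_param a r ` S (- pi) \<or> z \<in> log_param a r ` S (- pi / 2)" if z: "Fin z \<in> pdisc a r" for z
  proof -
    obtain \<zeta> where \<zeta>: "0 < Re \<zeta>" "Im \<zeta>0 - pi \<le> Im \<zeta>" "Im \<zeta> < Im \<zeta>0 + pi" "log_param a r \<zeta> = z"
      by (rule log_param_surj[OF r fin z])
    show ?thesis
    proof (cases "Im \<zeta>0 - pi = Im \<zeta>")
      case True
      \<comment> \<open>The excluded lower edge is moved by one period to height
        \<open>Im \<zeta>0 + pi\<close>, inside the second strip.\<close>
      define \<xi> where "\<xi> = \<zeta> + 2 * of_real pi * \<i>"
      have "exp \<xi> = exp \<zeta>" by (simp add: \<xi>_def exp_add)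
      then have "exp (- \<xi>) = exp (- \<zeta>)" by (simp only: exp_minus)
      then have "log_param a r \<xi> = z" using \<zeta>(4) by (simp add: log_param_def)
      moreover have "\<xi> \<in> S (- pi / 2)" using \<zeta>(1) True[symmetric]
        by (simp add: S_def \<xi>_def) (use pi_gt_zero in linarith)
      ultimately show ?thesis by blast
    next
      case False
      then have "\<zeta> \<in> S (- pi)" using \<zeta> by (simp add: S_def)
      then show ?thesis using \<zeta>(4) by blast
    qed
  qed
  show ?thesis
    using that[OF h1(1) h2(1)] cover h1(2) h2(2) by blast
qed

lemma distortion_constant_pos:
  assumes r: "0 < r" "r < 1" and lam: "0 < lam" "lam < 1"
  shows "0 < distortion_constant r lam"
proof -
  have "lam * r < 1" using r lam mult_strict_mono[of lam 1 r 1] by simp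
  then have "0 < ln (1 / (lam * r))" using r lam by simp
  moreover have "0 < ln (1 / lam)" using lam by simp
  ultimately show ?thesis
    unfolding distortion_constant_def by (intro mult_pos_pos zero_less_power divide_pos_pos add_pos_pos) auto
qed

theorem mainTheorem3:
  fixes r lam :: real
  assumes "0 < r" "r < 1" "0 < lam" "lam < 1"
  shows "\<exists>c>0. \<forall>a f U. logarithmic_tract f U a r \<and> 0 \<notin> U \<longrightarrow>
    (\<forall>z1 z2. Fin z1 \<in> pdisc a r \<and> Fin z2 \<in> pdisc a r \<and>
        dist (Fin z1) a \<le> dist (Fin z2) a \<and> dist (Fin z2) a \<le> lam * r \<longrightarrow>
      (\<forall>D g. inverse_branch f U D g \<and> z1 \<in> D \<longrightarrow>
        (\<exists>E h. branch_extension f U z1 g E h \<and> z2 \<in> E \<and> distortion_bounds c a h z1 z2)) \<and>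
      (\<forall>D g. inverse_branch f U D g \<and> z2 \<in> D \<longrightarrow>
        (\<exists>E h. branch_extension f U z2 g E h \<and> z1 \<in> E \<and> distortion_bounds c a h z1 z2))) \<and>
    (\<forall>z1 D g. Fin z1 \<in> pdisc a r \<and> dist (Fin z1) a \<le> lam * r \<and>
        inverse_branch f U D g \<and> z1 \<in> D \<longrightarrow>
      (\<exists>E1 g1 E2 g2. branch_extension f U z1 g E1 g1 \<and> branch_extension f U z1 g E2 g2 \<and>
        (\<forall>z2. Fin z2 \<in> pdisc a r \<and>
            dist (Fin z1) a \<le> dist (Fin z2) a \<and> dist (Fin z2) a \<le> lam * r \<longrightarrow>
          z2 \<in> E1 \<and> distortion_bounds c a g1 z1 z2 \<or>
          z2 \<in> E2 \<and> distortion_bounds c a g2 z1 z2))) \<and>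
    (\<forall>z2 D g. Fin z2 \<in> pdisc a r \<and> dist (Fin z2) a \<le> lam * r \<and>
        inverse_branch f U D g \<and> z2 \<in> D \<longrightarrow>
      (\<exists>E1 g1 E2 g2. branch_extension f U z2 g E1 g1 \<and> branch_extension f U z2 g E2 g2 \<and>
        (\<forall>z1. Fin z1 \<in> pdisc a r \<and> dist (Fin z1) a \<le> dist (Fin z2) a \<longrightarrow>
          z1 \<in> E1 \<and> distortion_bounds c a g1 z1 z2 \<or>
          z1 \<in> E2 \<and> distortion_bounds c a g2 z1 z2)))"
proof (rule exI[of _ "distortion_constant r lam"], rule conjI[OF distortion_constant_pos[OF assms]],
    intro allI impI, elim conjE)
  let ?c = "distortion_constant r lam"
  fix a f U
  assume lt: "logarithmic_tract f U a r" "0 \<notin> U"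
  note two = two_branch_extensions[OF assms lt]
  \<comment> \<open>Once the other point is fixed, one of the two extensions serves it; this gives
    the statements with a single extension and the same constant.\<close>
  have fst_ext: "\<exists>E h. branch_extension f U z1 g E h \<and> z2 \<in> E \<and> distortion_bounds ?c a h z1 z2"
    if "Fin z2 \<in> pdisc a r" "dist (Fin z1) a \<le> dist (Fin z2) a" "dist (Fin z2) a \<le> lam * r"
      and g: "inverse_branch f U D g" "z1 \<in> D" for z1 z2 D g
    by (rule two[OF g]) (use that(1-3) in blast)
  have snd_ext: "\<exists>E h. branch_extension f U z2 g E h \<and> z1 \<in> E \<and> distortion_bounds ?c a h z1 z2"
    if "Fin z1 \<in> pdisc a r" "dist (Fin z1) a \<le> dist (Fin z2) a" "dist (Fin z2) a \<le> lam * r"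
      and g: "inverse_branch f U D g" "z2 \<in> D" for z1 z2 D g
    by (rule two[OF g]) (use that(1-3) in blast)
  have fst_two: "\<exists>E1 g1 E2 g2. branch_extension f U z1 g E1 g1 \<and> branch_extension f U z1 g E2 g2 \<and>
        (\<forall>z2. Fin z2 \<in> pdisc a r \<and>
            dist (Fin z1) a \<le> dist (Fin z2) a \<and> dist (Fin z2) a \<le> lam * r \<longrightarrow>
          z2 \<in> E1 \<and> distortion_bounds ?c a g1 z1 z2 \<or>
          z2 \<in> E2 \<and> distortion_bounds ?c a g2 z1 z2)"
    if g: "inverse_branch f U D g" "z1 \<in> D" for z1 D g
    by (rule two[OF g]) blast
  have snd_two: "\<exists>E1 g1 E2 g2. branch_extension f U z2 g E1 g1 \<and> branch_extension f U z2 g E2 g2 \<and>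
        (\<forall>z1. Fin z1 \<in> pdisc a r \<and> dist (Fin z1) a \<le> dist (Fin z2) a \<longrightarrow>
          z1 \<in> E1 \<and> distortion_bounds ?c a g1 z1 z2 \<or>
          z1 \<in> E2 \<and> distortion_bounds ?c a g2 z1 z2)"
    if "dist (Fin z2) a \<le> lam * r" and g: "inverse_branch f U D g" "z2 \<in> D" for z2 D g
    by (rule two[OF g]) (use that(1) in blast)
  show "(\<forall>z1 z2. Fin z1 \<in> pdisc a r \<and> Fin z2 \<in> pdisc a r \<and>
        dist (Fin z1) a \<le> dist (Fin z2) a \<and> dist (Fin z2) a \<le> lam * r \<longrightarrow>
      (\<forall>D g. inverse_branch f U D g \<and> z1 \<in> D \<longrightarrow>
        (\<exists>E h. branch_extension f U z1 g E h \<and> z2 \<in> E \<and> distortion_bounds ?c a h z1 z2)) \<and>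
      (\<forall>D g. inverse_branch f U D g \<and> z2 \<in> D \<longrightarrow>
        (\<exists>E h. branch_extension f U z2 g E h \<and> z1 \<in> E \<and> distortion_bounds ?c a h z1 z2))) \<and>
    (\<forall>z1 D g. Fin z1 \<in> pdisc a r \<and> dist (Fin z1) a \<le> lam * r \<and>
        inverse_branch f U D g \<and> z1 \<in> D \<longrightarrow>
      (\<exists>E1 g1 E2 g2. branch_extension f U z1 g E1 g1 \<and> branch_extension f U z1 g E2 g2 \<and>
        (\<forall>z2. Fin z2 \<in> pdisc a r \<and>
            dist (Fin z1) a \<le> dist (Fin z2) a \<and> dist (Fin z2) a \<le> lam * r \<longrightarrow>
          z2 \<in> E1 \<and> distortion_bounds ?c a g1 z1 z2 \<or>
          z2 \<in> E2 \<and> distortion_bounds ?c a g2 z1 z2))) \<and>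
    (\<forall>z2 D g. Fin z2 \<in> pdisc a r \<and> dist (Fin z2) a \<le> lam * r \<and>
        inverse_branch f U D g \<and> z2 \<in> D \<longrightarrow>
      (\<exists>E1 g1 E2 g2. branch_extension f U z2 g E1 g1 \<and> branch_extension f U z2 g E2 g2 \<and>
        (\<forall>z1. Fin z1 \<in> pdisc a r \<and> dist (Fin z1) a \<le> dist (Fin z2) a \<longrightarrow>
          z1 \<in> E1 \<and> distortion_bounds ?c a g1 z1 z2 \<or>
          z1 \<in> E2 \<and> distortion_bounds ?c a g2 z1 z2)))"
    by (intro conjI allI impI; elim conjE; (rule fst_ext snd_ext fst_two snd_two; assumption))
qed

end
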